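(* Let $M$ be an Orlicz function which is $\mathcal{C}^3$ on $[0,+\infty)$, such that $M^{(3)}$ is increasing, $M(t)=o(t^3)$ when $t\to 0$, and $M$ satisfies the $\Delta_{2++}$-condition at $0$. Suppose additionally that $M(1)=1$, and that for every $\varepsilon>0$ there exists $\alpha(\varepsilon)>1$ such that for every $0<t,u\leqslant 1-\varepsilon$, it holds that $M(tu)\geqslant\alpha(\varepsilon)M(t)M(u)$. Then the space $\ell_M$ is cofinally Fraïssé.
   Context: All spaces are real. An Orlicz function is a convex function $M\colon[0,+\infty)\to[0,+\infty)$ with $M(0)=0$ and $\lim_{t\to\infty}M(t)=\infty$. For a real sequence $x=(x(k))_{k\in\mathbb{N}}$, the Luxemburg norm is $\|x\|_M=\inf\{\rho>0 : \sum_k M(|x(k)|/\rho)\leqslant 1\}$ (with $\inf\varnothing=+\infty$); the Orlicz sequence space is $\ell_M=\{x\in\mathbb{R}^{\mathbb{N}} : \|x\|_M<\infty\}$ with the norm $\|\cdot\|_M$. An Orlicz function $M$ of class $\mathcal{C}^3$ on $(0,+\infty)$ satisfies the $\Delta_{2++}$-condition at $0$ if for every $i\in\{1,2,3\}$, $\limsup_{t\to 0}\frac{tM^{(i)}(t)}{M^{(i-1)}(t)}<\infty$. $\operatorname{Iso}(X)$ is the group of all surjective linear isometries of $X$. For a finite-dimensional subspace $E\subseteq X$ and $C\geqslant 1$, $\operatorname{Emb}_C(E,X)$ is the set of all linear injections $T\colon E\to X$ with $\max(\|T\|,\|T^{-1}\|)\leqslant C$ ($T^{-1}$ being defined on $T(E)$),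 with the operator-norm distance and the action of $\operatorname{Iso}(X)$ by left composition. A group $G$ acts $\varepsilon$-transitively on a metric space $(N,d)$ if $d(y,Gx)\leqslant\varepsilon$ for all $x,y\in N$. For finite-dimensional subspaces $E,F$ of $X$ and $\varepsilon>0$, write $E\subseteq_\varepsilon F$ if every $x$ in the unit sphere $S_E$ is at distance at most $\varepsilon$ from the unit sphere $S_F$. A class $\mathcal{F}$ of finite-dimensional subspaces of $X$ is cofinal in $X$ if for every finite-dimensional subspace $E\subseteq X$ and every $\varepsilon>0$, there exists $F\in\mathcal{F}$ such that $E\subseteq_\varepsilon F$. A separable Banach space $X$ is cofinally Fraïssé if for every $\varepsilon>0$, there is a cofinal class $\mathcal{F}$ of finite-dimensional subspaces of $X$ such that for every $E\in\mathcal{F}$, there exists $\delta>0$ such that $\operatorname{Iso}(X)$ acts $\varepsilon$-transitively on $\operatorname{Emb}_{1+\delta}(E,X)$. *)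

theory Defs
  imports "HOL-Analysis.Analysis" "HOL-Library.Function_Algebras" "HOL-Library.Landau_Symbols"
begin

section \<open>Real sequences as a real vector space\<close>

text \<open>Addition and zero of functions are the pointwise ones of \<^theory>\<open>HOL-Library.Function_Algebras\<close>.\<close>

instantiation "fun" :: (type, real_vector) real_vector
begin

definition scaleR_fun :: "real \<Rightarrow> ('a \<Rightarrow> 'b) \<Rightarrow> 'a \<Rightarrow> 'b" where
  "scaleR_fun c f = (\<lambda>x. c *\<^sub>R f x)"

instance
  by standard (auto simp: scaleR_fun_def fun_eq_iff algebra_simps)

end

section \<open>Normed spaces given by a carrier and a norm\<close>

text \<open>
  Since the Orlicz space depends on the function \<open>M\<close>, a normed space is a linear subspace \<open>X\<close> of
  some real vector space together with a function \<open>N\<close>, of which only the values on \<open>X\<close> matter.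
\<close>

definition normed_space_on :: "'v::real_vector set \<Rightarrow> ('v \<Rightarrow> real) \<Rightarrow> bool" where
  "normed_space_on X N \<longleftrightarrow>
     subspace X \<and>
     (\<forall>x\<in>X. 0 \<le> N x \<and> (N x = 0 \<longleftrightarrow> x = 0)) \<and>
     (\<forall>c. \<forall>x\<in>X. N (c *\<^sub>R x) = \<bar>c\<bar> * N x) \<and>
     (\<forall>x\<in>X. \<forall>y\<in>X. N (x + y) \<le> N x + N y)"

definition separable_banach_on :: "'v::real_vector set \<Rightarrow> ('v \<Rightarrow> real) \<Rightarrow> bool" where
  "separable_banach_on X N \<longleftrightarrow>
     normed_space_on X N \<and>
     Metric_space.mcomplete X (\<lambda>x y. N (x - y)) \<and>
     separable_space (Metric_space.mtopology X (\<lambda>x y. N (x - y)))"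

definition findim_subspaces :: "'v::real_vector set \<Rightarrow> 'v set set" where
  "findim_subspaces X = {E. E \<subseteq> X \<and> (\<exists>B. finite B \<and> E = span B)}"

definition linear_map_on :: "'v::real_vector set \<Rightarrow> ('v \<Rightarrow> 'w::real_vector) \<Rightarrow> bool" where
  "linear_map_on E T \<longleftrightarrow>
     (\<forall>x\<in>E. \<forall>y\<in>E. T (x + y) = T x + T y) \<and> (\<forall>c. \<forall>x\<in>E. T (c *\<^sub>R x) = c *\<^sub>R T x)"

text \<open>Extended-real valued, so that no boundedness is presupposed.\<close>

definition opnorm :: "('v \<Rightarrow> real) \<Rightarrow> 'v set \<Rightarrow> ('v \<Rightarrow> 'v) \<Rightarrow> ereal" where
  "opnorm N E T = (SUP x\<in>{x\<in>E. N x \<le> 1}. ereal (N (T x)))"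

definition unit_sphere :: "('v \<Rightarrow> real) \<Rightarrow> 'v set \<Rightarrow> 'v set" where
  "unit_sphere N E = {x\<in>E. N x = 1}"

text \<open>
  Distance from a point to a set, equal to \<open>\<infinity>\<close> for the empty set (for instance the unit sphere of
  the zero subspace).
\<close>

definition dist_to_set :: "('n \<Rightarrow> 'n \<Rightarrow> ereal) \<Rightarrow> 'n \<Rightarrow> 'n set \<Rightarrow> ereal" where
  "dist_to_set d y A = (INF a\<in>A. d y a)"

section \<open>Isometries, embeddings and cofinally Fraisse spaces\<close>

text \<open>
  Maps defined on a subspace are represented by extensional functions (equal to \<^const>\<open>undefined\<close>
  outside of it); hence left composition is the extensional \<^const>\<open>compose\<close>.
\<close>

definition Iso :: "'v::real_vector set \<Rightarrow> ('v \<Rightarrow> real) \<Rightarrow> ('v \<Rightarrow> 'v) set" where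
  "Iso X N = {g \<in> X \<rightarrow>\<^sub>E X. linear_map_on X g \<and> g ` X = X \<and> (\<forall>x\<in>X. N (g x) = N x)}"

definition Emb :: "'v::real_vector set \<Rightarrow> ('v \<Rightarrow> real) \<Rightarrow> real \<Rightarrow> 'v set \<Rightarrow> ('v \<Rightarrow> 'v) set" where
  "Emb X N C E = {T \<in> E \<rightarrow>\<^sub>E X. linear_map_on E T \<and> inj_on T E \<and>
     max (opnorm N E T) (opnorm N (T ` E) (inv_into E T)) \<le> ereal C}"

definition opdist :: "('v::real_vector \<Rightarrow> real) \<Rightarrow> 'v set \<Rightarrow> ('v \<Rightarrow> 'v) \<Rightarrow> ('v \<Rightarrow> 'v) \<Rightarrow> ereal" where
  "opdist N E S T = opnorm N E (\<lambda>x. S x - T x)"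

definition acts_eps_transitively ::
  "real \<Rightarrow> 'g set \<Rightarrow> ('g \<Rightarrow> 'n \<Rightarrow> 'n) \<Rightarrow> 'n set \<Rightarrow> ('n \<Rightarrow> 'n \<Rightarrow> ereal) \<Rightarrow> bool" where
  "acts_eps_transitively \<epsilon> G act A d \<longleftrightarrow>
     (\<forall>x\<in>A. \<forall>y\<in>A. dist_to_set d y ((\<lambda>g. act g x) ` G) \<le> ereal \<epsilon>)"

definition subset_eps :: "('v::real_vector \<Rightarrow> real) \<Rightarrow> real \<Rightarrow> 'v set \<Rightarrow> 'v set \<Rightarrow> bool" where
  "subset_eps N \<epsilon> E F \<longleftrightarrow>
     (\<forall>x\<in>unit_sphere N E.
        dist_to_set (\<lambda>x y. ereal (N (x - y))) x (unit_sphere N F) \<le> ereal \<epsilon>)"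

definition cofinal_class :: "'v::real_vector set \<Rightarrow> ('v \<Rightarrow> real) \<Rightarrow> 'v set set \<Rightarrow> bool" where
  "cofinal_class X N \<F> \<longleftrightarrow>
     \<F> \<subseteq> findim_subspaces X \<and>
     (\<forall>E\<in>findim_subspaces X. \<forall>\<epsilon>>0. \<exists>F\<in>\<F>. subset_eps N \<epsilon> E F)"

definition cofinally_Fraisse :: "'v::real_vector set \<Rightarrow> ('v \<Rightarrow> real) \<Rightarrow> bool" where
  "cofinally_Fraisse X N \<longleftrightarrow>
     separable_banach_on X N \<and>
     (\<forall>\<epsilon>>0. \<exists>\<F>. cofinal_class X N \<F> \<and>
        (\<forall>E\<in>\<F>. \<exists>\<delta>>0.
           acts_eps_transitively \<epsilon> (Iso X N) (compose E) (Emb X N (1 + \<delta>) E) (opdist N E)))"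

section \<open>Orlicz functions and Orlicz sequence spaces\<close>

text \<open>
  Functions on \<open>[0,\<infinity>)\<close> are represented by functions on the reals; their values at negative
  arguments are irrelevant.
\<close>

definition orlicz_function :: "(real \<Rightarrow> real) \<Rightarrow> bool" where
  "orlicz_function M \<longleftrightarrow>
     (\<forall>t\<ge>0. 0 \<le> M t) \<and> convex_on {0..} M \<and> M 0 = 0 \<and> filterlim M at_top at_top"

definition luxemburg :: "(real \<Rightarrow> real) \<Rightarrow> (nat \<Rightarrow> real) \<Rightarrow> ereal" where
  "luxemburg M x = Inf (ereal ` {\<rho>. \<rho> > 0 \<and> (\<Sum>k. ennreal (M (\<bar>x k\<bar> / \<rho>))) \<le> 1})"

definition orlicz_space :: "(real \<Rightarrow> real) \<Rightarrow> (nat \<Rightarrow> real) set" where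
  "orlicz_space M = {x. luxemburg M x < \<infinity>}"

definition orlicz_norm :: "(real \<Rightarrow> real) \<Rightarrow> (nat \<Rightarrow> real) \<Rightarrow> real" where
  "orlicz_norm M x = real_of_ereal (luxemburg M x)"

text \<open>Iterated derivatives relative to \<open>S\<close>, hence one-sided at \<open>0\<close> when \<open>S = [0,\<infinity>)\<close>.\<close>

primrec nth_deriv_on :: "real set \<Rightarrow> nat \<Rightarrow> (real \<Rightarrow> real) \<Rightarrow> real \<Rightarrow> real" where
  "nth_deriv_on S 0 f = f"
| "nth_deriv_on S (Suc i) f = (\<lambda>t. vector_derivative (nth_deriv_on S i f) (at t within S))"

definition C_k_on :: "nat \<Rightarrow> real set \<Rightarrow> (real \<Rightarrow> real) \<Rightarrow> bool" where
  "C_k_on k S f \<longleftrightarrow>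
     (\<forall>i<k. nth_deriv_on S i f differentiable_on S) \<and> continuous_on S (nth_deriv_on S k f)"

text \<open>
  The quotients must make sense near \<open>0\<close>; this is required explicitly because \<open>x / 0 = 0\<close> in HOL.
\<close>

definition Delta_2pp :: "(real \<Rightarrow> real) \<Rightarrow> bool" where
  "Delta_2pp M \<longleftrightarrow>
     C_k_on 3 {0<..} M \<and>
     (\<forall>i\<in>{1,2,3}.
        (\<forall>\<^sub>F t in at_right 0. nth_deriv_on {0<..} (i - 1) M t \<noteq> 0) \<and>
        Limsup (at_right 0)
          (\<lambda>t. ereal (t * nth_deriv_on {0<..} i M t / nth_deriv_on {0<..} (i - 1) M t)) < \<infinity>)"

end

theory Submission
  imports Defs
begin

text \<open>
  The cofinal class, the same for every \<open>\<epsilon>\<close>, consists of the coordinate subspaces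
  \<open>span {e\<^sub>0, \<dots>, e\<^sub>n\<^sub>-\<^sub>1}\<close> with \<open>n \<ge> 2\<close>. The point is that an almost isometric embedding of such
  a space is close to one sending each \<open>e\<^sub>i\<close> to a signed unit vector \<open>\<plusminus> e\<^sub>k\<close>, with distinct \<open>k\<close> for
  distinct \<open>i\<close>. Any two embeddings of the latter kind differ by a signed permutation of all the
  coordinates, which is an isometry of \<open>\<ell>\<^sub>M\<close> (lemma \<open>Iso_moves_near\<close>). A single unit vector can be
  moved anywhere on the sphere by an isometric embedding of its span, hence \<open>n \<ge> 2\<close>.

  Exactly isometric embeddings show why this happens. Let \<open>x\<close>, \<open>y\<close> be the images of \<open>e\<^sub>i\<close>, \<open>e\<^sub>j\<close>, write
  \<open>\<Phi> x = (\<Sum>k. M \<bar>x k\<bar>)\<close>, and choose \<open>a\<close> with \<open>M a = 1/2\<close>. Then \<open>a (e\<^sub>i \<plusminus> e\<^sub>j)\<close> has norm \<open>1\<close>, so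
  \<open>\<Phi> (a (x \<plusminus> y)) \<le> 1\<close>. Smoothness and growth of \<open>M\<close> yield the Clarkson-type inequality
  \<open>2 M(s) + 2 M(t) \<le> M(s + t) + M \<bar>s - t\<bar>\<close> (lemma \<open>clarkson_if_C3\<close>), so \<open>\<Phi> (a x) + \<Phi> (a y) \<le> 1\<close>.
  On the other hand \<open>M(tu) \<ge> M(t) M(u)\<close> gives \<open>\<Phi> (a x) \<ge> M a \<cdot> \<Phi> x = 1/2\<close>, likewise for \<open>y\<close>, and the
  strict form of supermultiplicativity makes the inequality for \<open>x\<close> strict unless some coordinate of
  \<open>x\<close> has absolute value \<open>1\<close>. As \<open>\<Phi> x = 1\<close>, the other coordinates then vanish. This
  reasoning is stable under small errors (lemmas \<open>large_coordinate\<close> and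
  \<open>near_unit_if_large_coordinate\<close>): supermultiplicativity also implies a doubling condition, by which
  norms close to \<open>1\<close> correspond to modulars close to \<open>1\<close> and small modulars to small norms.

  Cofinality holds because every finite-dimensional space of sequences has a basis dual to finitely
  many coordinate functionals, and these have norm at most \<open>1\<close>; thus truncation converges uniformly
  on its unit ball.
\<close>

section \<open>A Clarkson-type inequality\<close>

lemma C_k_on_has_real_derivative:
  assumes "C_k_on n S f" "i < n" "t \<in> S"
  shows "(nth_deriv_on S i f has_real_derivative nth_deriv_on S (Suc i) f t) (at t within S)"
  using assms vector_derivative_works
  by (fastforce simp: C_k_on_def differentiable_on_def has_real_derivative_iff_has_vector_derivative)

lemma real_derivative_zero_if_quadratic:
  fixes f :: "real \<Rightarrow> real"
  assumes D: "(f has_real_derivative D) (at 0 within {0..})" and "f 0 = 0"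
    and ev: "\<forall>\<^sub>F t in at_right 0. 0 \<le> f t \<and> f t \<le> K * t\<^sup>2"
  shows "D = 0"
proof -
  have "((\<lambda>t. f t / t) \<longlongrightarrow> D) (at_right 0)"
    using D \<open>f 0 = 0\<close> by (simp add: has_field_derivative_iff at_within_Ici_at_right)
  moreover have "((\<lambda>t. f t / t) \<longlongrightarrow> 0) (at_right 0)"
  proof (rule real_tendsto_sandwich)
    show "\<forall>\<^sub>F t in at_right 0. 0 \<le> f t / t"
      using ev eventually_at_right_less[of "0::real"] by eventually_elim auto
    show "\<forall>\<^sub>F t in at_right 0. f t / t \<le> K * t"
      using ev eventually_at_right_less[of "0::real"]
      by eventually_elim (auto simp: field_simps power2_eq_square)
    show "((\<lambda>t. K * t) \<longlongrightarrow> 0) (at_right 0)"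
      by (auto intro!: tendsto_eq_intros)
  qed simp
  ultimately show ?thesis
    using tendsto_unique trivial_limit_at_right_real by blast
qed

text \<open>Increments of a convex function over intervals of fixed length are nondecreasing.\<close>

lemma increments_mono:
  fixes f f' :: "real \<Rightarrow> real"
  assumes D: "\<And>t. t > 0 \<Longrightarrow> (f has_real_derivative f' t) (at t)"
    and cont: "continuous_on {0..} f"
    and mono: "\<And>s t. 0 < s \<Longrightarrow> s \<le> t \<Longrightarrow> f' s \<le> f' t"
    and "0 \<le> x" "x \<le> y" "0 \<le> d"
  shows "f (x + d) - f x \<le> f (y + d) - f y"
proof (rule DERIV_nonneg_imp_increasing_open[where f = "\<lambda>z. f (z + d) - f z"])
  show "\<exists>D. ((\<lambda>z. f (z + d) - f z) has_real_derivative D) (at z) \<and> 0 \<le> D"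
    if "x < z" "z < y" for z
  proof (intro exI conjI)
    have "z > 0" using that \<open>0 \<le> x\<close> by simp
    with D[of "z + d"] D[of z] \<open>0 \<le> d\<close>
    show "((\<lambda>z. f (z + d) - f z) has_real_derivative (f' (z + d) - f' z)) (at z)"
      by (auto intro!: derivative_eq_intros simp: DERIV_shift)
    show "0 \<le> f' (z + d) - f' z" using mono[of z "z + d"] \<open>z > 0\<close> \<open>0 \<le> d\<close> by simp
  qed
  show "continuous_on {x..y} (\<lambda>z. f (z + d) - f z)"
    using \<open>0 \<le> x\<close> \<open>0 \<le> d\<close>
    by (intro continuous_intros continuous_on_compose2[OF cont]) auto
qed fact

text \<open>For \<open>0 \<le> h \<le> s\<close> the difference of the two sides vanishes at \<open>h = 0\<close>, and its
  derivative in \<open>h\<close> is the increment of \<open>M'\<close> over \<open>[s - h, s + h]\<close> minus \<open>2 M'(h)\<close>. As \<open>M'\<close> is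
  convex and vanishes at \<open>0\<close>, this increment is at least that over \<open>[0, 2 h]\<close>, hence at least \<open>2 M'(h)\<close>.\<close>

lemma clarkson_if_convex_derivative:
  fixes M M1 M2 :: "real \<Rightarrow> real"
  assumes D1: "\<And>t. t > 0 \<Longrightarrow> (M has_real_derivative M1 t) (at t)"
    and D2: "\<And>t. t > 0 \<Longrightarrow> (M1 has_real_derivative M2 t) (at t)"
    and cont: "continuous_on {0..} M" "continuous_on {0..} M1"
    and zero: "M 0 = 0" "M1 0 = 0"
    and mono: "\<And>s t. 0 < s \<Longrightarrow> s \<le> t \<Longrightarrow> M2 s \<le> M2 t"
  shows "2 * M \<bar>x\<bar> + 2 * M \<bar>y\<bar> \<le> M \<bar>x + y\<bar> + M \<bar>x - y\<bar>"
proof -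
  have main: "2 * M s + 2 * M h \<le> M (s + h) + M (s - h)" if "0 \<le> h" "h \<le> s" for s h
  proof -
    let ?f = "\<lambda>h. M (s + h) + M (s - h) - 2 * M s - 2 * M h"
    have "?f 0 \<le> ?f h"
    proof (rule DERIV_nonneg_imp_increasing_open[where f = ?f])
      fix k assume k: "0 < k" "k < h"
      have "M1 (0 + 2 * k) - M1 0 \<le> M1 (s - k + 2 * k) - M1 (s - k)"
        by (rule increments_mono[OF D2 cont(2) mono]) (use k that in auto)
      moreover have "M1 (0 + k) - M1 0 \<le> M1 (k + k) - M1 k"
        by (rule increments_mono[OF D2 cont(2) mono]) (use k in auto)
      ultimately have "0 \<le> M1 (s + k) - M1 (s - k) - 2 * M1 k"
        using zero by (simp add: algebra_simps)
      moreover have "(M has_real_derivative M1 (s + k)) (at (s + k))"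
          "(M has_real_derivative M1 (s - k)) (at (s - k))" "(M has_real_derivative M1 k) (at k)"
        using D1 k that by auto
      then have "(?f has_real_derivative (M1 (s + k) - M1 (s - k) - 2 * M1 k)) (at k)"
        by (auto intro!: derivative_eq_intros DERIV_chain'[where g = M])
      ultimately show "\<exists>y. (?f has_real_derivative y) (at k) \<and> 0 \<le> y" by blast
    next
      show "continuous_on {0..h} ?f"
        using that by (intro continuous_intros continuous_on_compose2[OF cont(1)]) auto
    qed fact
    with zero show ?thesis by simp
  qed
  have *: "M \<bar>x + y\<bar> + M \<bar>x - y\<bar> = M (\<bar>x\<bar> + \<bar>y\<bar>) + M \<bar>\<bar>x\<bar> - \<bar>y\<bar>\<bar>"
    by (smt (verit))
  show ?thesis
  proof (cases "\<bar>y\<bar> \<le> \<bar>x\<bar>")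
    case True
    with main[of "\<bar>y\<bar>" "\<bar>x\<bar>"] * show ?thesis by simp
  next
    case False
    with main[of "\<bar>x\<bar>" "\<bar>y\<bar>"] * show ?thesis by (simp add: add.commute)
  qed
qed

text \<open>The tangent to \<open>M\<close> at \<open>t\<close>, evaluated at \<open>2 t\<close>, gives \<open>t M'(t) \<le> M(2 t)\<close>, so smallness of \<open>M\<close>
  at \<open>0\<close> passes to \<open>M'\<close> and forces \<open>M'(0) = M''(0) = 0\<close>. As \<open>M'' \<ge> 0\<close>, the mean value theorem
  finds points arbitrarily close to \<open>0\<close> where \<open>M''' \<ge> 0\<close>; as \<open>M'''\<close> is nondecreasing, it is
  nonnegative on \<open>(0,\<infinity>)\<close>, and \<open>M'\<close> is convex.\<close>

lemma clarkson_if_C3: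
  fixes M :: "real \<Rightarrow> real"
  assumes orl: "orlicz_function M"
    and C3: "C_k_on 3 {0..} M"
    and mono: "mono_on {0..} (nth_deriv_on {0..} 3 M)"
    and small: "M \<in> o[at_right 0](\<lambda>t. t ^ 3)"
  shows "2 * M \<bar>x\<bar> + 2 * M \<bar>y\<bar> \<le> M \<bar>x + y\<bar> + M \<bar>x - y\<bar>"
proof -
  define M1 M2 M3 where "M1 = nth_deriv_on {0..} 1 M" and "M2 = nth_deriv_on {0..} 2 M"
    and "M3 = nth_deriv_on {0..} 3 M"
  have cvx: "convex_on {0..} M" and zero: "M 0 = 0" and nonneg: "\<And>t. t \<ge> 0 \<Longrightarrow> 0 \<le> M t"
    using orl by (auto simp: orlicz_function_def)
  have D1: "(M has_real_derivative M1 t) (at t within {0..})"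
   and D2: "(M1 has_real_derivative M2 t) (at t within {0..})"
   and D3: "(M2 has_real_derivative M3 t) (at t within {0..})" if "t \<ge> 0" for t
    using that C_k_on_has_real_derivative[OF C3, of 0 t] C_k_on_has_real_derivative[OF C3, of 1 t]
      C_k_on_has_real_derivative[OF C3, of 2 t]
    by (simp_all add: M1_def M2_def M3_def numeral_2_eq_2 numeral_3_eq_3)
  have cont: "continuous_on {0..} M" "continuous_on {0..} M1" "continuous_on {0..} M2"
    using D1 D2 D3 by (auto intro!: DERIV_continuous_on)
  have int: "at t within {0..} = at t" if "t > 0" for t :: real
    using that by (intro at_within_nhd[where S = "{0<..}"]) auto
  have tangent: "M1 c * (u - c) \<le> M u - M c" if "c > 0" "u \<ge> 0" for c u
    using that by (intro convex_on_imp_above_tangent[OF cvx]) (auto simp: D1)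
  have M1_nonneg: "0 \<le> M1 t" if "t > 0" for t
  proof -
    have "0 \<le> M1 t * t" using tangent[of t 0] nonneg[of t] that zero by simp
    with that show ?thesis by (simp add: zero_le_mult_iff)
  qed
  have M1_le: "M1 t * t \<le> M (2 * t)" if "t > 0" for t
    using tangent[of t "2 * t"] nonneg[of t] that by simp
  have M1_mono: "M1 s \<le> M1 t" if "0 < s" "s \<le> t" for s t
  proof -
    have "M1 s * (t - s) \<le> M1 t * (t - s)"
      using tangent[of s t] tangent[of t s] that by (simp add: algebra_simps)
    with that show ?thesis by (cases "s = t") auto
  qed
  have "\<forall>\<^sub>F t in at_right 0. norm (M t) \<le> 1 * norm (t ^ 3)"
    by (rule landau_o.smallD[OF small]) simp
  then obtain b :: real where "b > 0" and "\<forall>t>0. t < b \<longrightarrow> norm (M t) \<le> 1 * norm (t ^ 3)"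
    unfolding eventually_at_right_field by blast
  then have cubic: "M t \<le> t ^ 3" if "0 < t" "t < b" for t
    using that by fastforce
  have "M1 0 = 0"
  proof (rule real_derivative_zero_if_quadratic[OF D1])
    show "\<forall>\<^sub>F t in at_right 0. 0 \<le> M t \<and> M t \<le> b * t\<^sup>2"
      unfolding eventually_at_right_field
    proof (intro exI conjI allI impI)
      fix t assume t: "0 < t" "t < b"
      with cubic[OF t] show "M t \<le> b * t\<^sup>2"
        by (smt (verit) mult_right_mono power2_eq_square power3_eq_cube mult.assoc zero_le_power2)
    qed (use \<open>b > 0\<close> nonneg in auto)
  qed (use zero in auto)
  have "M2 0 = 0"
  proof (rule real_derivative_zero_if_quadratic[OF D2])
    show "\<forall>\<^sub>F t in at_right 0. 0 \<le> M1 t \<and> M1 t \<le> 8 * t\<^sup>2"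
      unfolding eventually_at_right_field
    proof (intro exI conjI allI impI)
      fix t assume t: "0 < t" "t < b / 2"
      have "M1 t * t \<le> (2 * t) ^ 3"
        using M1_le[of t] cubic[of "2 * t"] t by simp
      then have "M1 t * t \<le> (8 * t\<^sup>2) * t"
        by (simp add: power2_eq_square power3_eq_cube)
      with t show "M1 t \<le> 8 * t\<^sup>2" by (meson mult_le_cancel_right_pos)
    qed (use \<open>b > 0\<close> M1_nonneg in auto)
  qed (use \<open>M1 0 = 0\<close> in auto)
  have M2_nonneg: "0 \<le> M2 t" if "t > 0" for t
  proof (rule mono_on_imp_deriv_nonneg)
    show "mono_on {0<..} M1" using M1_mono by (auto simp: mono_on_def)
    show "(M1 has_real_derivative M2 t) (at t)" using D2[of t] that int[of t] by simp
  qed (use that in \<open>simp add: interior_open\<close>)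
  have M3_nonneg: "0 \<le> M3 t" if "t > 0" for t
  proof -
    obtain z where z: "0 < z" "z < t" "M2 t - M2 0 = M3 z * (t - 0)"
    proof (rule mvt[where f = M2 and f' = "\<lambda>z. (*) (M3 z)" and a = 0 and b = t])
      show "continuous_on {0..t} M2" using cont(3) by (auto intro: continuous_on_subset)
      show "(M2 has_derivative (*) (M3 z)) (at z)" if "0 < z" for z
        using D3[of z] int[OF that] that by (simp add: has_field_derivative_def)
    qed (use \<open>t > 0\<close> in auto)
    then have "0 \<le> M3 z" using M2_nonneg[OF that] \<open>M2 0 = 0\<close> that by (simp add: zero_le_mult_iff)
    also have "M3 z \<le> M3 t" using mono z by (auto simp: M3_def mono_on_def)
    finally show ?thesis .
  qed
  have M2_mono: "M2 s \<le> M2 t" if "0 < s" "s \<le> t" for s t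
  proof (rule DERIV_nonneg_imp_increasing_open[where f = M2])
    show "\<exists>y. (M2 has_real_derivative y) (at z) \<and> 0 \<le> y" if "s < z" "z < t" for z
      using D3[of z] M3_nonneg[of z] int[of z] that \<open>0 < s\<close> by auto
    show "continuous_on {s..t} M2" using cont(3) that by (auto intro: continuous_on_subset)
  qed fact
  show ?thesis
  proof (rule clarkson_if_convex_derivative[where M = M and ?M1.0 = M1 and ?M2.0 = M2])
    show "(M has_real_derivative M1 t) (at t)" "(M1 has_real_derivative M2 t) (at t)" if "t > 0" for t
      using D1[of t] D2[of t] int[OF that] that by simp_all
  qed (fact cont zero \<open>M1 0 = 0\<close> M2_mono)+
qed

section \<open>The Luxemburg norm\<close>

text \<open>This turns membership in a ball of the Luxemburg norm into a condition on finite sums of reals,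
  which is stable under pointwise limits and under reindexing.\<close>

lemma suminf_ennreal_le_one_iff:
  fixes f :: "nat \<Rightarrow> real"
  assumes "\<And>k. 0 \<le> f k"
  shows "(\<Sum>k. ennreal (f k)) \<le> 1 \<longleftrightarrow> (\<forall>F. finite F \<longrightarrow> sum f F \<le> 1)"
proof
  assume L: "(\<Sum>k. ennreal (f k)) \<le> 1"
  show "\<forall>F. finite F \<longrightarrow> sum f F \<le> 1"
  proof (intro allI impI)
    fix F :: "nat set" assume "finite F"
    then have "(\<Sum>k\<in>F. ennreal (f k)) \<le> (\<Sum>k. ennreal (f k))"
      by (intro sum_le_suminf) auto
    also note L
    finally show "sum f F \<le> 1" using assms by (simp add: sum_ennreal)
  qed
next
  assume R: "\<forall>F. finite F \<longrightarrow> sum f F \<le> 1"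
  have "(\<Sum>k<n. ennreal (f k)) \<le> 1" for n
    using assms R by (simp add: sum_ennreal)
  then show "(\<Sum>k. ennreal (f k)) \<le> 1"
    by (intro suminf_le_const) auto
qed

definition unit_seq :: "nat \<Rightarrow> nat \<Rightarrow> real" where
  "unit_seq k = (\<lambda>j. if j = k then 1 else 0)"

definition trunc :: "nat \<Rightarrow> (nat \<Rightarrow> real) \<Rightarrow> nat \<Rightarrow> real" where
  "trunc n x = (\<lambda>k. if k < n then x k else 0)"

locale normalised_orlicz =
  fixes M :: "real \<Rightarrow> real"
  assumes convex: "convex_on {0..} M"
    and zero [simp]: "M 0 = 0"
    and one [simp]: "M 1 = 1"
    and pos: "0 < t \<Longrightarrow> 0 < M t"
    and cont: "continuous_on {0..} M"
begin

lemma nonneg [simp]: "0 \<le> t \<Longrightarrow> 0 \<le> M t"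
  using pos[of t] by (cases "t = 0") auto

lemma convexD: "0 \<le> a \<Longrightarrow> 0 \<le> b \<Longrightarrow> a + b = 1 \<Longrightarrow> 0 \<le> s \<Longrightarrow> 0 \<le> t
    \<Longrightarrow> M (a * s + b * t) \<le> a * M s + b * M t"
  using convex by (simp add: convex_on_def)

lemma scale_le: "0 \<le> a \<Longrightarrow> a \<le> 1 \<Longrightarrow> 0 \<le> t \<Longrightarrow> M (a * t) \<le> a * M t"
  using convexD[of a "1 - a" t 0] by simp

lemma strict_mono: "0 \<le> s \<Longrightarrow> s < t \<Longrightarrow> M s < M t"
proof -
  assume "0 \<le> s" "s < t"
  then have "M (s / t * t) \<le> s / t * M t" by (intro scale_le) auto
  also have "\<dots> < 1 * M t" using \<open>0 \<le> s\<close> \<open>s < t\<close> by (intro mult_strict_right_mono pos) auto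
  finally show ?thesis using \<open>0 \<le> s\<close> \<open>s < t\<close> by simp
qed

lemma mono: "0 \<le> s \<Longrightarrow> s \<le> t \<Longrightarrow> M s \<le> M t"
  using strict_mono[of s t] by (cases "s = t") auto

lemma le_iff: "0 \<le> s \<Longrightarrow> 0 \<le> t \<Longrightarrow> M s \<le> M t \<longleftrightarrow> s \<le> t"
  by (meson linorder_not_le mono strict_mono)

lemma le_one_iff: "0 \<le> s \<Longrightarrow> M s \<le> 1 \<longleftrightarrow> s \<le> 1"
  using le_iff[of s 1] by simp

abbreviation X where "X \<equiv> orlicz_space M"
abbreviation N where "N \<equiv> orlicz_norm M"

lemma sum_div_mono:
  assumes "0 < r" "r \<le> s"
  shows "(\<Sum>k\<in>F. M (\<bar>x k\<bar> / s)) \<le> (\<Sum>k\<in>F. M (\<bar>x k\<bar> / r))"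
  using assms by (intro sum_mono mono) (simp_all add: frac_le)

text \<open>The infimum defining the Luxemburg norm is attained, since \<open>M\<close> is continuous.\<close>

lemma luxemburg_le_iff:
  assumes "r > 0"
  shows "luxemburg M x \<le> ereal r \<longleftrightarrow> (\<forall>F. finite F \<longrightarrow> (\<Sum>k\<in>F. M (\<bar>x k\<bar> / r)) \<le> 1)"
proof -
  have mod: "(\<Sum>k. ennreal (M (\<bar>x k\<bar> / s))) \<le> 1 \<longleftrightarrow> (\<forall>F. finite F \<longrightarrow> (\<Sum>k\<in>F. M (\<bar>x k\<bar> / s)) \<le> 1)"
    if "s > 0" for s
    using that by (intro suminf_ennreal_le_one_iff) auto
  show ?thesis
  proof
    assume L: "luxemburg M x \<le> ereal r"
    show "\<forall>F. finite F \<longrightarrow> (\<Sum>k\<in>F. M (\<bar>x k\<bar> / r)) \<le> 1"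
    proof (intro allI impI)
      fix F :: "nat set" assume "finite F"
      have le: "(\<Sum>k\<in>F. M (\<bar>x k\<bar> / s)) \<le> 1" if "s > r" for s
      proof -
        have "luxemburg M x < ereal s" using L that by (meson ereal_less_eq(3) less_ereal.simps(1) order_le_less_trans)
        then obtain \<rho> where \<rho>: "\<rho> < s" "\<rho> > 0" "(\<Sum>k. ennreal (M (\<bar>x k\<bar> / \<rho>))) \<le> 1"
          unfolding luxemburg_def Inf_less_iff by auto
        then have "(\<Sum>k\<in>F. M (\<bar>x k\<bar> / \<rho>)) \<le> 1" using mod \<open>finite F\<close> by blast
        with sum_div_mono[of \<rho> s x F] \<rho> show ?thesis by simp
      qed
      have "continuous_on {r..} (\<lambda>s. \<Sum>k\<in>F. M (\<bar>x k\<bar> / s))"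
        using \<open>r > 0\<close> by (intro continuous_intros continuous_on_compose2[OF cont]) auto
      then have "((\<lambda>s. \<Sum>k\<in>F. M (\<bar>x k\<bar> / s)) \<longlongrightarrow> (\<Sum>k\<in>F. M (\<bar>x k\<bar> / r))) (at_right r)"
        by (metis atLeast_iff order_refl continuous_on_def at_within_Ici_at_right)
      moreover have "\<forall>\<^sub>F s in at_right r. (\<Sum>k\<in>F. M (\<bar>x k\<bar> / s)) \<le> 1"
        using eventually_at_right_less[of r] by eventually_elim (rule le)
      ultimately show "(\<Sum>k\<in>F. M (\<bar>x k\<bar> / r)) \<le> 1"
        by (rule tendsto_upperbound) simp
    qed
  next
    assume "\<forall>F. finite F \<longrightarrow> (\<Sum>k\<in>F. M (\<bar>x k\<bar> / r)) \<le> 1"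
    then show "luxemburg M x \<le> ereal r"
      unfolding luxemburg_def using assms mod by (intro Inf_lower) auto
  qed
qed

lemma luxemburg_nonneg: "0 \<le> luxemburg M x"
  unfolding luxemburg_def by (rule Inf_greatest) auto

lemma luxemburg_eq: "x \<in> X \<Longrightarrow> luxemburg M x = ereal (N x)"
  using luxemburg_nonneg[of x] by (cases "luxemburg M x") (auto simp: orlicz_space_def orlicz_norm_def)

lemma norm_nonneg [simp]: "0 \<le> N x"
  using luxemburg_nonneg[of x] by (simp add: orlicz_norm_def real_of_ereal_pos)

lemma norm_leD:
  assumes "x \<in> X" "N x \<le> r" "0 < r" "finite F"
  shows "(\<Sum>k\<in>F. M (\<bar>x k\<bar> / r)) \<le> 1"
  using luxemburg_le_iff[of r x] assms luxemburg_eq by simp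

lemma norm_leI:
  assumes "0 < r" "\<And>F. finite F \<Longrightarrow> (\<Sum>k\<in>F. M (\<bar>x k\<bar> / r)) \<le> 1"
  shows "x \<in> X" "N x \<le> r"
proof -
  have le: "luxemburg M x \<le> ereal r" using assms luxemburg_le_iff by blast
  then show "x \<in> X" unfolding orlicz_space_def using ereal_infty_less(1) le_less_trans by fastforce
  with le show "N x \<le> r" by (simp add: luxemburg_eq)
qed

lemma norm_gtD:
  assumes "x \<in> X" "r < N x" "0 < r"
  obtains F where "finite F" "(\<Sum>k\<in>F. M (\<bar>x k\<bar> / r)) > 1"
  using norm_leI(2)[of r x] assms by fastforce

lemma abs_le_norm: "x \<in> X \<Longrightarrow> \<bar>x k\<bar> \<le> N x"
proof (rule field_le_epsilon)
  fix e :: real assume "x \<in> X" "0 < e"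
  then have r: "0 < N x + e" using norm_nonneg[of x] by linarith
  have "(\<Sum>k\<in>{k}. M (\<bar>x k\<bar> / (N x + e))) \<le> 1"
    using \<open>x \<in> X\<close> \<open>0 < e\<close> r by (intro norm_leD) auto
  then show "\<bar>x k\<bar> \<le> N x + e" using r by (simp add: le_one_iff)
qed

lemma zero_mem: "0 \<in> X" and norm_zero [simp]: "N 0 = 0"
proof -
  show "0 \<in> X" by (rule norm_leI(1)[of 1]) auto
  have "N 0 \<le> 0 + e" if "0 < e" for e
    using that by (intro norm_leI(2)) auto
  then have "N 0 \<le> 0" by (rule field_le_epsilon)
  with norm_nonneg[of 0] show "N 0 = 0" by linarith
qed

lemma norm_eq_zero_iff: "x \<in> X \<Longrightarrow> N x = 0 \<longleftrightarrow> x = 0"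
  using abs_le_norm[of x] norm_zero by (metis abs_le_zero_iff ext zero_fun_apply)

lemma scaleR_mem_le:
  assumes "x \<in> X"
  shows "c *\<^sub>R x \<in> X" "N (c *\<^sub>R x) \<le> \<bar>c\<bar> * N x"
proof -
  have *: "c *\<^sub>R x \<in> X \<and> N (c *\<^sub>R x) \<le> \<bar>c\<bar> * r" if "c \<noteq> 0" "N x < r" for r
  proof -
    have "r > 0" using that norm_nonneg[of x] by linarith
    have "(\<Sum>k\<in>F. M (\<bar>(c *\<^sub>R x) k\<bar> / (\<bar>c\<bar> * r))) \<le> 1" if "finite F" for F
      using norm_leD[of x r F] that \<open>c \<noteq> 0\<close> \<open>N x < r\<close> \<open>r > 0\<close> assms
      by (simp add: scaleR_fun_def abs_mult)
    with norm_leI[of "\<bar>c\<bar> * r" "c *\<^sub>R x"] \<open>c \<noteq> 0\<close> \<open>r > 0\<close> show ?thesis by auto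
  qed
  show "c *\<^sub>R x \<in> X" using *[of "N x + 1"] zero_mem by (cases "c = 0") auto
  show "N (c *\<^sub>R x) \<le> \<bar>c\<bar> * N x"
  proof (cases "c = 0")
    case False
    have "N (c *\<^sub>R x) / \<bar>c\<bar> \<le> N x"
    proof (rule field_le_epsilon)
      fix e :: real assume "0 < e"
      with *[of "N x + e"] False show "N (c *\<^sub>R x) / \<bar>c\<bar> \<le> N x + e" by (simp add: field_simps)
    qed
    with False show ?thesis by (simp add: field_simps)
  qed simp
qed

lemma norm_scaleR:
  assumes "x \<in> X"
  shows "N (c *\<^sub>R x) = \<bar>c\<bar> * N x"
proof (cases "c = 0")
  case False
  have "N (inverse c *\<^sub>R c *\<^sub>R x) \<le> \<bar>inverse c\<bar> * N (c *\<^sub>R x)"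
    using assms by (intro scaleR_mem_le)
  then have "\<bar>c\<bar> * N x \<le> N (c *\<^sub>R x)" using False by (simp add: field_simps)
  with scaleR_mem_le(2)[OF assms, of c] show ?thesis by simp
qed simp

text \<open>For \<open>N x < r\<close> and \<open>N y < s\<close>, the vector \<open>(x + y) / (r + s)\<close> is the convex combination of
  \<open>x / r\<close> and \<open>y / s\<close> with weights \<open>r / (r + s)\<close> and \<open>s / (r + s)\<close>.\<close>

lemma add_mem_le:
  assumes "x \<in> X" "y \<in> X"
  shows "x + y \<in> X" "N (x + y) \<le> N x + N y"
proof -
  have *: "x + y \<in> X \<and> N (x + y) \<le> r + s" if "N x < r" "N y < s" for r s
  proof -
    have "r > 0" "s > 0" using that norm_nonneg[of x] norm_nonneg[of y] by linarith+
    have "(\<Sum>k\<in>F. M (\<bar>(x + y) k\<bar> / (r + s))) \<le> 1" if "finite F" for F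
    proof -
      let ?a = "r / (r + s)" and ?b = "s / (r + s)"
      have "M (\<bar>(x + y) k\<bar> / (r + s)) \<le> ?a * M (\<bar>x k\<bar> / r) + ?b * M (\<bar>y k\<bar> / s)" for k
      proof -
        have "M (\<bar>(x + y) k\<bar> / (r + s)) \<le> M (?a * (\<bar>x k\<bar> / r) + ?b * (\<bar>y k\<bar> / s))"
          using \<open>r > 0\<close> \<open>s > 0\<close> by (intro mono) (auto simp: divide_simps)
        also have "\<dots> \<le> ?a * M (\<bar>x k\<bar> / r) + ?b * M (\<bar>y k\<bar> / s)"
          using \<open>r > 0\<close> \<open>s > 0\<close> by (intro convexD) (auto simp: add_divide_distrib[symmetric])
        finally show ?thesis .
      qed
      then have "(\<Sum>k\<in>F. M (\<bar>(x + y) k\<bar> / (r + s)))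
          \<le> (\<Sum>k\<in>F. ?a * M (\<bar>x k\<bar> / r) + ?b * M (\<bar>y k\<bar> / s))"
        by (intro sum_mono)
      also have "\<dots> = ?a * (\<Sum>k\<in>F. M (\<bar>x k\<bar> / r)) + ?b * (\<Sum>k\<in>F. M (\<bar>y k\<bar> / s))"
        by (simp only: sum.distrib sum_distrib_left)
      also have "\<dots> \<le> ?a * 1 + ?b * 1"
        using norm_leD[of x r F] norm_leD[of y s F] assms \<open>N x < r\<close> \<open>N y < s\<close> that \<open>r > 0\<close> \<open>s > 0\<close>
        by (intro add_mono mult_left_mono) auto
      also have "\<dots> = 1" using \<open>r > 0\<close> \<open>s > 0\<close> by (simp add: add_divide_distrib[symmetric])
      finally show ?thesis .
    qed
    with norm_leI[of "r + s" "x + y"] \<open>r > 0\<close> \<open>s > 0\<close> show ?thesis by auto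
  qed
  show "x + y \<in> X" using *[of "N x + 1" "N y + 1"] by simp
  show "N (x + y) \<le> N x + N y"
  proof (rule field_le_epsilon)
    fix e :: real assume "0 < e"
    with *[of "N x + e / 2" "N y + e / 2"] show "N (x + y) \<le> N x + N y + e" by simp
  qed
qed

lemma subspace_space: "subspace X"
  using zero_mem add_mem_le scaleR_mem_le by (simp add: subspace_def)

lemma normed_space: "normed_space_on X N"
  using subspace_space norm_eq_zero_iff norm_scaleR add_mem_le(2) by (simp add: normed_space_on_def)

lemmas mem_intros = subspace_0[OF subspace_space] subspace_add[OF subspace_space]
  subspace_diff[OF subspace_space] subspace_scale[OF subspace_space] subspace_sum[OF subspace_space]

lemma norm_minus_commute: "x \<in> X \<Longrightarrow> y \<in> X \<Longrightarrow> N (x - y) = N (y - x)"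
  using norm_scaleR[of "x - y" "-1"] by (simp add: mem_intros)

lemma norm_triangle: "x \<in> X \<Longrightarrow> y \<in> X \<Longrightarrow> z \<in> X \<Longrightarrow> N (x - z) \<le> N (x - y) + N (y - z)"
  using add_mem_le(2)[of "x - y" "y - z"] by (simp add: mem_intros)

lemma norm_diff_ineq: "x \<in> X \<Longrightarrow> y \<in> X \<Longrightarrow> N x \<le> N y + N (x - y)"
  using add_mem_le(2)[of y "x - y"] by (simp add: mem_intros)

lemma norm_sum_le:
  "(\<And>i. i \<in> I \<Longrightarrow> f i \<in> X) \<Longrightarrow> N (\<Sum>i\<in>I. f i) \<le> (\<Sum>i\<in>I. N (f i))"
proof (induction I rule: infinite_finite_induct)
  case (insert i I)
  then have "N (f i + sum f I) \<le> N (f i) + N (sum f I)"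
    by (intro add_mem_le) (auto intro: mem_intros)
  also have "\<dots> \<le> N (f i) + (\<Sum>i\<in>I. N (f i))" using insert by simp
  finally show ?case by (simp only: sum.insert[OF insert(1,2)])
qed auto

lemma unit_seq_mem: "unit_seq k \<in> X" and norm_unit_seq [simp]: "N (unit_seq k) = 1"
proof -
  have "(\<Sum>j\<in>F. M (\<bar>unit_seq k j\<bar> / 1)) \<le> 1" if "finite F" for F
  proof -
    have "M (\<bar>unit_seq k j\<bar> / 1) = (if j = k then 1 else 0)" for j by (simp add: unit_seq_def)
    then show ?thesis using that by simp
  qed
  from norm_leI[OF _ this] have *: "unit_seq k \<in> X" "N (unit_seq k) \<le> 1" by auto
  then show "unit_seq k \<in> X" by simp
  with * abs_le_norm[of "unit_seq k" k] show "N (unit_seq k) = 1" by (simp add: unit_seq_def)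
qed

lemma metric: "Metric_space X (\<lambda>x y. N (x - y))"
proof
  fix x y z
  show "0 \<le> N (x - y)" by simp
  show "N (x - y) = N (y - x)"
  proof -
    have "luxemburg M (x - y) = luxemburg M (y - x)"
      by (simp add: luxemburg_def abs_minus_commute)
    then show ?thesis by (simp add: orlicz_norm_def)
  qed
  assume "x \<in> X" "y \<in> X"
  then show "N (x - y) = 0 \<longleftrightarrow> x = y" by (simp add: norm_eq_zero_iff mem_intros)
  assume "z \<in> X"
  with \<open>x \<in> X\<close> \<open>y \<in> X\<close> show "N (x - z) \<le> N (x - y) + N (y - z)" by (rule norm_triangle)
qed

text \<open>A Cauchy sequence converges coordinatewise, and the bounds on finite sums pass to the limit.\<close>

lemma complete: "Metric_space.mcomplete X (\<lambda>x y. N (x - y))"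
proof -
  interpret Metric_space X "\<lambda>x y. N (x - y)" by (rule metric)
  have "\<exists>u. limitin mtopology \<sigma> u sequentially" if "MCauchy \<sigma>" for \<sigma>
  proof -
    have mem: "\<sigma> n \<in> X" for n using that by (auto simp: MCauchy_def)
    have Cauchy: "\<exists>n0. \<forall>n\<ge>n0. \<forall>m\<ge>n0. N (\<sigma> n - \<sigma> m) < e" if "e > 0" for e
      using \<open>MCauchy \<sigma>\<close> that by (auto simp: MCauchy_def)
    have "convergent (\<lambda>n. \<sigma> n k)" for k
    proof (rule Cauchy_convergent, rule metric_CauchyI)
      fix e :: real assume "0 < e"
      then obtain n0 where n0: "\<And>n m. n \<ge> n0 \<Longrightarrow> m \<ge> n0 \<Longrightarrow> N (\<sigma> n - \<sigma> m) < e"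
        using Cauchy by blast
      have "dist (\<sigma> m k) (\<sigma> n k) < e" if "n \<ge> n0" "m \<ge> n0" for n m
        using abs_le_norm[of "\<sigma> m - \<sigma> n" k] n0[of m n] that mem
        by (simp add: mem_intros dist_real_def)
      then show "\<exists>n0. \<forall>m\<ge>n0. \<forall>n\<ge>n0. dist (\<sigma> m k) (\<sigma> n k) < e" by blast
    qed
    then obtain u where u: "\<And>k. (\<lambda>n. \<sigma> n k) \<longlonglongrightarrow> u k"
      unfolding convergent_def by metis
    have close: "\<sigma> n - u \<in> X \<and> N (\<sigma> n - u) \<le> e"
      if "e > 0" and near: "\<And>m. m \<ge> n0 \<Longrightarrow> N (\<sigma> n - \<sigma> m) < e" for e n n0
    proof -
      have "(\<Sum>k\<in>F. M (\<bar>(\<sigma> n - u) k\<bar> / e)) \<le> 1" if "finite F" for F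
      proof (rule tendsto_upperbound)
        show "(\<lambda>m. \<Sum>k\<in>F. M (\<bar>(\<sigma> n - \<sigma> m) k\<bar> / e)) \<longlonglongrightarrow> (\<Sum>k\<in>F. M (\<bar>(\<sigma> n - u) k\<bar> / e))"
        proof (rule tendsto_sum)
          fix k
          have "(\<lambda>m. \<bar>(\<sigma> n - \<sigma> m) k\<bar> / e) \<longlonglongrightarrow> \<bar>(\<sigma> n - u) k\<bar> / e"
            unfolding fun_diff_def using \<open>e > 0\<close> by (intro tendsto_intros u) simp
          then show "(\<lambda>m. M (\<bar>(\<sigma> n - \<sigma> m) k\<bar> / e)) \<longlonglongrightarrow> M (\<bar>(\<sigma> n - u) k\<bar> / e)"
            by (rule continuous_on_tendsto_compose[OF cont]) (use \<open>e > 0\<close> in auto)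
        qed
        show "\<forall>\<^sub>F m in sequentially. (\<Sum>k\<in>F. M (\<bar>(\<sigma> n - \<sigma> m) k\<bar> / e)) \<le> 1"
          using eventually_ge_at_top[of n0]
        proof eventually_elim
          case (elim m)
          show ?case
            using near[OF elim] mem \<open>finite F\<close> \<open>e > 0\<close> by (intro norm_leD mem_intros less_imp_le)
        qed
      qed simp
      then show ?thesis using norm_leI[of e "\<sigma> n - u"] \<open>e > 0\<close> by auto
    qed
    have "u \<in> X"
    proof -
      obtain n0 where n0: "\<And>m. m \<ge> n0 \<Longrightarrow> N (\<sigma> n0 - \<sigma> m) < 1" using Cauchy[of 1] by auto
      have "\<sigma> n0 - (\<sigma> n0 - u) \<in> X"
        by (rule subspace_diff[OF subspace_space]) (use close[of 1 n0 n0] n0 mem in auto)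
      moreover have "\<sigma> n0 - (\<sigma> n0 - u) = u" by (simp only: diff_diff_eq2 add_diff_cancel_left')
      ultimately show ?thesis by simp
    qed
    have "\<forall>\<^sub>F n in sequentially. \<sigma> n \<in> X \<and> N (\<sigma> n - u) < e" if "e > 0" for e
    proof -
      obtain n0 where n0: "\<And>n m. n \<ge> n0 \<Longrightarrow> m \<ge> n0 \<Longrightarrow> N (\<sigma> n - \<sigma> m) < e / 2"
        using Cauchy[OF half_gt_zero[OF \<open>e > 0\<close>]] by blast
      show ?thesis using eventually_ge_at_top[of n0]
      proof eventually_elim
        case (elim n)
        have "N (\<sigma> n - u) \<le> e / 2" using close[OF half_gt_zero[OF \<open>e > 0\<close>] n0[OF elim]] by simp
        with that mem show ?case by simp
      qed
    qed
    with \<open>u \<in> X\<close> show ?thesis by (auto simp: limitin_metric)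
  qed
  then show ?thesis by (simp add: mcomplete_def)
qed

end

lemma sum_fun_apply: "(\<Sum>i\<in>I. f i) x = (\<Sum>i\<in>I. f i x)"
  by (induction I rule: infinite_finite_induct) auto

context normalised_orlicz begin

section \<open>Truncations and coordinate subspaces\<close>

abbreviation coord_space :: "nat \<Rightarrow> (nat \<Rightarrow> real) set" where
  "coord_space n \<equiv> span (unit_seq ` {..<n})"

lemma trunc_eq_sum: "trunc n x = (\<Sum>k<n. x k *\<^sub>R unit_seq k)"
proof
  fix j
  have "(x k *\<^sub>R unit_seq k) j = (if k = j then x j else 0)" for k
    by (simp add: scaleR_fun_def unit_seq_def)
  then show "trunc n x j = (\<Sum>k<n. x k *\<^sub>R unit_seq k) j"
    by (simp add: sum_fun_apply trunc_def)
qed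

lemma trunc_mem: "trunc n x \<in> X" and trunc_mem_coord_space: "trunc n x \<in> coord_space n"
  unfolding trunc_eq_sum
  by (auto intro!: mem_intros unit_seq_mem) (intro span_sum span_scale span_base, auto)

lemma coord_space_subset: "coord_space n \<subseteq> X"
  using subspace_space unit_seq_mem by (intro span_minimal) auto

lemma trunc_coord_space: "x \<in> coord_space n \<Longrightarrow> trunc n x = x"
proof (rule span_induct[where S = "unit_seq ` {..<n}" and P = "\<lambda>x. trunc n x = x"])
  show "subspace {x. trunc n x = x}"
    by (auto simp: subspace_def trunc_def fun_eq_iff scaleR_fun_def)
qed (auto simp: trunc_def unit_seq_def)

lemma norm_trunc_le: "N (trunc n x) \<le> (\<Sum>k<n. \<bar>x k\<bar>)"
proof -
  have "N (\<Sum>k<n. x k *\<^sub>R unit_seq k) \<le> (\<Sum>k<n. N (x k *\<^sub>R unit_seq k))"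
    by (intro norm_sum_le mem_intros unit_seq_mem)
  also have "\<dots> = (\<Sum>k<n. \<bar>x k\<bar>)" by (simp add: norm_scaleR unit_seq_mem)
  finally show ?thesis by (simp only: trunc_eq_sum)
qed

end

section \<open>Supermultiplicative Orlicz functions\<close>

locale supermultiplicative_orlicz = normalised_orlicz +
  assumes supermult: "0 \<le> t \<Longrightarrow> t \<le> 1 \<Longrightarrow> 0 \<le> u \<Longrightarrow> u \<le> 1 \<Longrightarrow> M t * M u \<le> M (t * u)"
begin

text \<open>A doubling constant of \<open>M\<close> on \<open>[0,1]\<close>: for \<open>t \<le> 1/2\<close>, supermultiplicativity bounds \<open>M(2 t)\<close> by
  \<open>M(t) / M(1/2)\<close>, and for \<open>t \<ge> 1/2\<close> it suffices that \<open>M(2 t) \<le> M(2)\<close> and \<open>M(t) \<ge> M(1/2)\<close>.\<close>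

definition K where "K = M 2 / M (1/2)"

lemma K_nonneg: "0 \<le> K"
  by (simp add: K_def)

lemma doubling:
  assumes "0 \<le> t" "t \<le> 1"
  shows "M (2 * t) \<le> K * M t"
proof -
  have half: "0 < M (1/2)" by (simp add: pos)
  have "M (1/2) * M (2 * t) \<le> M 2 * M t"
  proof (cases "t \<le> 1/2")
    case True
    have "M (1/2) * M (2 * t) \<le> M (1/2 * (2 * t))" using True assms by (intro supermult) auto
    also have "\<dots> \<le> M 2 * M t" using mono[of 1 2] assms mult_right_mono[of 1 "M 2" "M t"] by simp
    finally show ?thesis .
  next
    case False
    have "M (2 * t) * M (1/2) \<le> M 2 * M t"
      using False assms by (intro mult_mono mono) auto
    then show ?thesis by (simp add: mult.commute)
  qed
  then show ?thesis using half by (simp add: K_def field_simps)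
qed

text \<open>By convexity and doubling, since \<open>(1 + \<theta>) t = (1 - \<theta>) t + \<theta> (2 t)\<close>.\<close>

lemma enlarge:
  assumes "0 \<le> \<theta>" "\<theta> \<le> 1" "0 \<le> t" "t \<le> 1"
  shows "M ((1 + \<theta>) * t) \<le> (1 + \<theta> * K) * M t"
proof -
  have "M ((1 - \<theta>) * t + \<theta> * (2 * t)) \<le> (1 - \<theta>) * M t + \<theta> * M (2 * t)"
    using assms by (intro convexD) auto
  also have "\<dots> \<le> 1 * M t + \<theta> * (K * M t)"
    using assms doubling[of t] by (intro add_mono mult_left_mono mult_right_mono) auto
  finally show ?thesis by (simp add: algebra_simps)
qed

text \<open>Near norm \<open>1\<close>, scaling a vector by \<open>1 + \<theta>\<close> costs its modular at most a factor \<open>1 + \<theta> K\<close>, by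
  \<open>enlarge\<close> in each coordinate. This bounds the modular from above here and, in
  \<open>modular_gt_if_norm_eq_one\<close>, from below.\<close>

lemma modular_le_if_norm_le:
  assumes "x \<in> X" "N x \<le> 1 + \<theta>" "0 \<le> \<theta>" "\<theta> \<le> 1" "finite F"
  shows "(\<Sum>k\<in>F. M \<bar>x k\<bar>) \<le> 1 + \<theta> * K"
proof -
  have "M \<bar>x k\<bar> \<le> (1 + \<theta> * K) * M (\<bar>x k\<bar> / (1 + \<theta>))" for k
    using enlarge[of \<theta> "\<bar>x k\<bar> / (1 + \<theta>)"] abs_le_norm[of x k] assms by simp
  then have "(\<Sum>k\<in>F. M \<bar>x k\<bar>) \<le> (1 + \<theta> * K) * (\<Sum>k\<in>F. M (\<bar>x k\<bar> / (1 + \<theta>)))"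
    unfolding sum_distrib_left by (rule sum_mono)
  also have "\<dots> \<le> (1 + \<theta> * K) * 1"
    using assms K_nonneg by (intro mult_left_mono norm_leD) auto
  finally show ?thesis by simp
qed

lemma modular_gt_if_norm_eq_one:
  assumes "x \<in> X" "N x = 1" "0 < \<theta>" "\<theta> \<le> 1"
  obtains F where "finite F" "1 < (1 + \<theta> * K) * (\<Sum>k\<in>F. M \<bar>x k\<bar>)"
proof -
  obtain F where F: "finite F" "1 < (\<Sum>k\<in>F. M (\<bar>x k\<bar> / (1 / (1 + \<theta>))))"
    using norm_gtD[of x "1 / (1 + \<theta>)"] assms by auto
  note F(2)
  also have "(\<Sum>k\<in>F. M (\<bar>x k\<bar> / (1 / (1 + \<theta>)))) \<le> (\<Sum>k\<in>F. (1 + \<theta> * K) * M \<bar>x k\<bar>)"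
    using enlarge[of \<theta>] abs_le_norm[of x] assms by (intro sum_mono) (auto simp: mult.commute)
  also have "\<dots> = (1 + \<theta> * K) * (\<Sum>k\<in>F. M \<bar>x k\<bar>)"
    by (simp only: sum_distrib_left)
  finally show ?thesis using that F(1) by blast
qed

text \<open>Supermultiplicativity in the form \<open>M(t / e) M(e) \<le> M(t)\<close> for \<open>t \<le> e\<close>; every coordinate satisfies
  \<open>\<bar>x k\<bar> \<le> e\<close> because already \<open>M \<bar>x k\<bar> \<le> M e\<close>.\<close>

lemma norm_le_if_modular_le:
  assumes "0 < e" "e \<le> 1" and small: "\<And>F. finite F \<Longrightarrow> (\<Sum>k\<in>F. M \<bar>x k\<bar>) \<le> M e"
  shows "x \<in> X" "N x \<le> e"
proof -
  have sum: "(\<Sum>k\<in>F. M (\<bar>x k\<bar> / e)) \<le> 1" if "finite F" for F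
  proof -
    have "M (\<bar>x k\<bar> / e) \<le> M \<bar>x k\<bar> / M e" for k
    proof -
      have "M \<bar>x k\<bar> \<le> M e" using small[of "{k}"] by simp
      then have "\<bar>x k\<bar> \<le> e" using le_iff[of "\<bar>x k\<bar>" e] assms by simp
      then have "M (\<bar>x k\<bar> / e) * M e \<le> M (\<bar>x k\<bar> / e * e)" using assms by (intro supermult) auto
      then show ?thesis using assms pos[of e] by (simp add: pos_le_divide_eq)
    qed
    then have "(\<Sum>k\<in>F. M (\<bar>x k\<bar> / e)) \<le> (\<Sum>k\<in>F. M \<bar>x k\<bar>) / M e"
      unfolding sum_divide_distrib by (rule sum_mono)
    also have "\<dots> \<le> 1" using small[OF that] pos[OF \<open>0 < e\<close>] by simp
    finally show ?thesis .
  qed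
  show "x \<in> X" "N x \<le> e" using norm_leI[of e x] sum \<open>0 < e\<close> by blast+
qed

text \<open>The modular is summable at some large scale \<open>\<rho>\<close>. As the coordinates tend to \<open>0\<close>,
  \<open>M(t / u) \<le> M(t) / M(u)\<close> for \<open>t \<le> u\<close> transfers summability from \<open>\<rho>\<close> to the
  smaller scale \<open>\<rho> u\<close>. This is what makes truncations converge in norm.\<close>

lemma summable_modular:
  assumes "x \<in> X" "0 < r"
  shows "summable (\<lambda>k. M (\<bar>x k\<bar> / r))"
proof -
  define \<rho> where "\<rho> = N x + r"
  define u where "u = r / \<rho>"
  have \<rho>: "0 < \<rho>" "r \<le> \<rho>" "N x \<le> \<rho>" using assms norm_nonneg[of x] by (auto simp: \<rho>_def add_nonneg_pos)
  have u: "0 < u" "u \<le> 1" "r = \<rho> * u" using \<rho> assms by (auto simp: u_def)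
  have sum: "summable (\<lambda>k. M (\<bar>x k\<bar> / \<rho>))"
    using assms \<rho> by (intro summableI_nonneg_bounded[where x = 1] norm_leD) auto
  then have "(\<lambda>k. M (\<bar>x k\<bar> / \<rho>)) \<longlonglongrightarrow> 0" by (rule summable_LIMSEQ_zero)
  then have "\<forall>\<^sub>F k in sequentially. M (\<bar>x k\<bar> / \<rho>) < M u"
    by (rule order_tendstoD) (simp add: pos u)
  then have "\<forall>\<^sub>F k in sequentially. norm (M (\<bar>x k\<bar> / r)) \<le> M (\<bar>x k\<bar> / \<rho>) / M u"
  proof eventually_elim
    case (elim k)
    then have "\<bar>x k\<bar> / \<rho> \<le> u" using le_iff[of "\<bar>x k\<bar> / \<rho>" u] \<rho> u by simp
    then have "M (\<bar>x k\<bar> / \<rho> / u) * M u \<le> M (\<bar>x k\<bar> / \<rho> / u * u)" using \<rho> u by (intro supermult) (auto simp: field_simps)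
    then show ?case using u \<rho> pos[of u] by (simp add: pos_le_divide_eq)
  qed
  then show ?thesis
    by (rule summable_comparison_test_ev) (rule summable_divide[OF sum])
qed

lemma trunc_approx:
  assumes "x \<in> X" "0 < e"
  obtains n0 where "\<And>n. n \<ge> n0 \<Longrightarrow> N (x - trunc n x) \<le> e"
proof -
  obtain n0 where n0: "\<And>m n. m \<ge> n0 \<Longrightarrow> norm (\<Sum>k\<in>{m..<n}. M (\<bar>x k\<bar> / e)) < 1"
    using summable_modular[OF assms] unfolding summable_Cauchy by (meson zero_less_one)
  have "N (x - trunc n x) \<le> e" if "n \<ge> n0" for n
  proof (rule norm_leI(2)[OF \<open>0 < e\<close>])
    fix F :: "nat set" assume "finite F"
    then obtain b where b: "F \<subseteq> {..<b}" using finite_nat_bounded by blast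
    have "(\<Sum>k\<in>F. M (\<bar>(x - trunc n x) k\<bar> / e)) \<le> (\<Sum>k<b. M (\<bar>(x - trunc n x) k\<bar> / e))"
      using b \<open>0 < e\<close> by (intro sum_mono2) auto
    also have "\<dots> = (\<Sum>k\<in>{n..<b}. M (\<bar>x k\<bar> / e))"
      by (rule sum.mono_neutral_cong_right) (auto simp: trunc_def)
    also have "\<dots> \<le> 1" using n0[OF that, of b] by simp
    finally show "(\<Sum>k\<in>F. M (\<bar>(x - trunc n x) k\<bar> / e)) \<le> 1" .
  qed
  with that show ?thesis by blast
qed

text \<open>Finitely supported rational sequences are dense.\<close>

lemma separable: "separable_space (Metric_space.mtopology X (\<lambda>x y. N (x - y)))"
proof -
  interpret Metric_space X "\<lambda>x y. N (x - y)" by (rule metric)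
  define f where "f qs = trunc (length qs) (\<lambda>k. real_of_rat (qs ! k))" for qs
  have "mtopology closure_of range f = X"
  proof (intro equalityI subsetI)
    fix x assume x: "x \<in> X"
    have "\<exists>y\<in>range f. y \<in> mcball x r" if "r > 0" for r
    proof -
      obtain n where n: "N (x - trunc n x) \<le> r / 2"
        using trunc_approx[OF x half_gt_zero[OF \<open>r > 0\<close>]] by (metis order_refl)
      define d where "d = r / (2 * (real n + 1))"
      have "0 < d" using that by (simp add: d_def)
      then have "\<exists>q. x k < real_of_rat q \<and> real_of_rat q < x k + d" for k
        by (intro of_rat_dense) simp
      then obtain q where q: "\<And>k. x k < real_of_rat (q k)" "\<And>k. real_of_rat (q k) < x k + d"
        by metis
      define y where "y = f (map q [0..<n])"
      have "trunc n x - y = trunc n (\<lambda>k. x k - real_of_rat (q k))"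
        by (auto simp: y_def f_def trunc_def fun_eq_iff)
      then have "N (trunc n x - y) \<le> (\<Sum>k<n. \<bar>x k - real_of_rat (q k)\<bar>)"
        using norm_trunc_le by simp
      also have "\<dots> \<le> (\<Sum>k<n. d)"
        using q by (intro sum_mono) (smt (verit))
      also have "\<dots> \<le> r / 2" using that by (simp add: d_def field_simps)
      finally have "N (x - y) \<le> r"
        using norm_triangle[of x "trunc n x" y] n x by (simp add: y_def f_def trunc_mem)
      moreover have "y \<in> X" by (simp add: y_def f_def trunc_mem)
      moreover have "y \<in> range f" unfolding y_def by (rule rangeI)
      ultimately show ?thesis using x by (auto simp: in_mcball)
    qed
    with x show "x \<in> mtopology closure_of range f" by (simp add: metric_closure_of_alt)
  qed (simp add: metric_closure_of)
  moreover have "range f \<subseteq> X" by (auto simp: f_def trunc_mem)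
  ultimately show ?thesis
    unfolding separable_space_def by (intro exI[of _ "range f"]) (simp add: topspace_mtopology)
qed

end

section \<open>Cofinality of the coordinate subspaces\<close>

text \<open>Gaussian elimination: a finite-dimensional space of sequences has a basis that is dual to
  finitely many of the coordinate functionals.\<close>

lemma dual_basis_of_coordinates:
  fixes B :: "(nat \<Rightarrow> real) set"
  assumes "finite B"
  obtains J b where "finite J" "\<And>k. k \<in> J \<Longrightarrow> b k \<in> span B"
    "\<And>x. x \<in> span B \<Longrightarrow> x = (\<Sum>k\<in>J. x k *\<^sub>R b k)"
proof -
  have "\<exists>J b. finite J \<and> (\<forall>k\<in>J. b k \<in> span B) \<and> (\<forall>k\<in>J. \<forall>l\<in>J. b k l = (if k = l then 1 else 0)) \<and>
      (\<forall>x\<in>span B. x = (\<Sum>k\<in>J. x k *\<^sub>R b k))"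
    using assms
  proof (induction B rule: finite_induct)
    case empty
    then show ?case by (intro exI[of _ "{}"]) auto
  next
    case (insert v B)
    from insert.IH obtain J b where IH: "finite J \<and> (\<forall>k\<in>J. b k \<in> span B) \<and>
      (\<forall>k\<in>J. \<forall>l\<in>J. b k l = (if k = l then 1 else 0)) \<and> (\<forall>x\<in>span B. x = (\<Sum>k\<in>J. x k *\<^sub>R b k))"
      by (elim exE)
    have J: "finite J" "\<And>k. k \<in> J \<Longrightarrow> b k \<in> span B"
      and dual: "\<And>k l. k \<in> J \<Longrightarrow> l \<in> J \<Longrightarrow> b k l = (if k = l then 1 else 0)"
      and rep: "\<And>x. x \<in> span B \<Longrightarrow> x = (\<Sum>k\<in>J. x k *\<^sub>R b k)"
      using IH by metis+
    have sub: "span B \<subseteq> span (insert v B)" by (intro span_mono) auto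
    define w where "w = v - (\<Sum>k\<in>J. v k *\<^sub>R b k)"
    have v: "v = w + (\<Sum>k\<in>J. v k *\<^sub>R b k)" by (simp add: w_def)
    have sum_mem: "(\<Sum>k\<in>J. v k *\<^sub>R b k) \<in> span B" using J by (intro span_sum span_scale)
    show ?case
    proof (cases "w = 0")
      case True
      then have "v \<in> span B" using v sum_mem by simp
      then have "span (insert v B) = span B" by (simp add: span_redundant)
      with J dual rep show ?thesis by (intro exI[of _ J] exI[of _ b]) simp
    next
      case False
      then obtain j where j: "w j \<noteq> 0" by (auto simp: fun_eq_iff)
      have w_zero: "w k = 0" if "k \<in> J" for k
      proof -
        have "(\<Sum>l\<in>J. v l *\<^sub>R b l) k = (\<Sum>l\<in>J. if l = k then v l else 0)"
          unfolding sum_fun_apply using dual that by (intro sum.cong) (auto simp: scaleR_fun_def)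
        also have "\<dots> = v k" using that J(1) by simp
        finally show ?thesis by (simp add: w_def)
      qed
      then have "j \<notin> J" using j by blast
      define c where "c = inverse (w j) *\<^sub>R w"
      have c: "c j = 1" "\<And>k. k \<in> J \<Longrightarrow> c k = 0" "w = w j *\<^sub>R c"
        using j w_zero by (auto simp: c_def scaleR_fun_def)
      have w_mem: "w \<in> span (insert v B)"
        unfolding w_def by (rule span_diff) (use sub sum_mem span_base in blast)+
      define b' where "b' k = (if k = j then c else b k - b k j *\<^sub>R c)" for k
      \<comment> \<open>The new sum is the old one, which reproduces \<open>x\<close> on \<open>span B\<close>, plus a correction by \<open>c\<close> that
        vanishes on \<open>span B\<close> and restores the missing multiple of \<open>w\<close> for \<open>x = v\<close>.\<close>
      have b'_sum: "(\<Sum>k\<in>insert j J. x k *\<^sub>R b' k) = (\<Sum>k\<in>J. x k *\<^sub>R b k) + (x - (\<Sum>k\<in>J. x k *\<^sub>R b k)) j *\<^sub>R c" for x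
      proof -
        have "(\<Sum>k\<in>J. x k *\<^sub>R b' k) = (\<Sum>k\<in>J. x k *\<^sub>R b k - (x k * b k j) *\<^sub>R c)"
          using \<open>j \<notin> J\<close> by (intro sum.cong) (auto simp: b'_def scaleR_right_diff_distrib)
        also have "\<dots> = (\<Sum>k\<in>J. x k *\<^sub>R b k) - (\<Sum>k\<in>J. x k *\<^sub>R b k) j *\<^sub>R c"
          by (simp add: sum_subtractf scaleR_sum_left[symmetric] sum_fun_apply scaleR_fun_def[of _ "b _"])
        finally show ?thesis
          using J(1) \<open>j \<notin> J\<close> by (simp add: b'_def[of j] algebra_simps)
      qed
      have rep': "x = (\<Sum>k\<in>insert j J. x k *\<^sub>R b' k)" if "x \<in> span (insert v B)" for x
        using that
      proof (rule span_induct)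
        show "subspace {x. x = (\<Sum>k\<in>insert j J. x k *\<^sub>R b' k)}"
        proof (rule subspaceI; clarify)
          show "0 = (\<Sum>k\<in>insert j J. (0 :: nat \<Rightarrow> real) k *\<^sub>R b' k)" by simp
        next
          fix x y assume xy: "x = (\<Sum>k\<in>insert j J. x k *\<^sub>R b' k)" "y = (\<Sum>k\<in>insert j J. y k *\<^sub>R b' k)"
          have "(\<Sum>k\<in>insert j J. (x + y) k *\<^sub>R b' k)
              = (\<Sum>k\<in>insert j J. x k *\<^sub>R b' k) + (\<Sum>k\<in>insert j J. y k *\<^sub>R b' k)"
            by (simp only: plus_fun_apply scaleR_add_left sum.distrib)
          then show "x + y = (\<Sum>k\<in>insert j J. (x + y) k *\<^sub>R b' k)" using xy by simp
        next
          fix a x assume x: "x = (\<Sum>k\<in>insert j J. x k *\<^sub>R b' k)"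
          have "(\<Sum>k\<in>insert j J. (a *\<^sub>R x) k *\<^sub>R b' k) = a *\<^sub>R (\<Sum>k\<in>insert j J. x k *\<^sub>R b' k)"
            by (simp only: scaleR_sum_right scaleR_fun_def[of a x] scaleR_scaleR real_scaleR_def)
          then show "a *\<^sub>R x = (\<Sum>k\<in>insert j J. (a *\<^sub>R x) k *\<^sub>R b' k)" using x by simp
        qed
      next
        fix x assume "x \<in> insert v B"
        then consider "x = v" | "x \<in> B" by blast
        then show "x = (\<Sum>k\<in>insert j J. x k *\<^sub>R b' k)"
        proof cases
          case 1
          show ?thesis unfolding b'_sum unfolding 1 w_def[symmetric] using v c(3) by (metis add.commute)
        next
          case 2
          then have "x - (\<Sum>k\<in>J. x k *\<^sub>R b k) = 0" using rep[of x] by (simp add: span_base)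
          then show ?thesis unfolding b'_sum by (simp add: algebra_simps)
        qed
      qed
      have c_mem: "c \<in> span (insert v B)" unfolding c_def by (intro span_scale w_mem)
      have "b' k \<in> span (insert v B)" if "k \<in> insert j J" for k
        using that J(2) sub c_mem by (auto simp: b'_def intro!: span_diff span_scale)
      moreover have "b' k l = (if k = l then 1 else 0)" if "k \<in> insert j J" "l \<in> insert j J" for k l
        using that dual \<open>j \<notin> J\<close> c(1,2) by (auto simp: b'_def scaleR_fun_def)
      ultimately show ?thesis using J(1) rep'
        by (intro exI[of _ "insert j J"] exI[of _ b']) blast
    qed
  qed
  then show ?thesis using that by blast
qed

context supermultiplicative_orlicz begin

text \<open>In a basis dual to coordinates, the coefficients of \<open>x\<close> are some of its coordinates, hence at
  most \<open>N x\<close>; so truncation converges uniformly once it does on the basis.\<close>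

lemma uniform_trunc_approx:
  assumes "finite B" "span B \<subseteq> X" "0 < e"
  obtains n0 where "\<And>n x. n \<ge> n0 \<Longrightarrow> x \<in> span B \<Longrightarrow> N (x - trunc n x) \<le> e * N x"
proof -
  obtain J b where J: "finite J" "\<And>k. k \<in> J \<Longrightarrow> b k \<in> span B"
    and rep: "\<And>x. x \<in> span B \<Longrightarrow> x = (\<Sum>k\<in>J. x k *\<^sub>R b k)"
    using dual_basis_of_coordinates[OF \<open>finite B\<close>] by metis
  define d where "d = e / (real (card J) + 1)"
  have "0 < d" using \<open>0 < e\<close> by (simp add: d_def)
  have bX: "b k \<in> X" if "k \<in> J" for k using J(2)[OF that] assms(2) by blast
  have "\<exists>n0. \<forall>n\<ge>n0. N (b k - trunc n (b k)) \<le> d" if "k \<in> J" for k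
    using trunc_approx[OF bX[OF that] \<open>0 < d\<close>] by metis
  then obtain n0 where n0: "\<And>k n. k \<in> J \<Longrightarrow> n \<ge> n0 k \<Longrightarrow> N (b k - trunc n (b k)) \<le> d"
    by metis
  have "N (x - trunc n x) \<le> e * N x" if n: "n \<ge> Max (insert 0 (n0 ` J))" and x: "x \<in> span B" for n x
  proof -
    have n': "n0 k \<le> n" if "k \<in> J" for k
      using n J(1) that by simp
    have "x - trunc n x = (\<Sum>k\<in>J. x k *\<^sub>R (b k - trunc n (b k)))"
    proof
      fix j
      have "x j = (\<Sum>k\<in>J. x k * b k j)"
        using fun_cong[OF rep[OF x], of j] by (simp add: sum_fun_apply scaleR_fun_def)
      then show "(x - trunc n x) j = (\<Sum>k\<in>J. x k *\<^sub>R (b k - trunc n (b k))) j"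
        by (simp add: sum_fun_apply scaleR_fun_def trunc_def)
    qed
    then have "N (x - trunc n x) = N (\<Sum>k\<in>J. x k *\<^sub>R (b k - trunc n (b k)))" by (rule arg_cong)
    also have "\<dots> \<le> (\<Sum>k\<in>J. N (x k *\<^sub>R (b k - trunc n (b k))))"
      by (intro norm_sum_le mem_intros bX trunc_mem)
    also have "\<dots> \<le> (\<Sum>k\<in>J. N x * d)"
    proof (rule sum_mono)
      fix k assume k: "k \<in> J"
      have "x \<in> X" using x assms(2) by blast
      then have "\<bar>x k\<bar> * N (b k - trunc n (b k)) \<le> N x * d"
        using n0[OF k n'[OF k]] abs_le_norm by (intro mult_mono) auto
      then show "N (x k *\<^sub>R (b k - trunc n (b k))) \<le> N x * d"
        using k by (simp add: norm_scaleR mem_intros bX trunc_mem)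
    qed
    also have "\<dots> = real (card J) * d * N x" by simp
    also have "\<dots> \<le> e * N x"
      using \<open>0 < e\<close> by (intro mult_right_mono) (auto simp: d_def field_simps)
    finally show ?thesis .
  qed
  with that show ?thesis by blast
qed

lemma coord_spaces_cofinal: "cofinal_class X N (coord_space ` {2..})"
  unfolding cofinal_class_def
proof (intro conjI ballI allI impI)
  show "coord_space ` {2..} \<subseteq> findim_subspaces X"
  proof (rule image_subsetI)
    fix n
    show "coord_space n \<in> findim_subspaces X"
      unfolding findim_subspaces_def
      by (intro CollectI conjI exI[of _ "unit_seq ` {..<n}"] coord_space_subset) simp_all
  qed
next
  fix E and e :: real assume "E \<in> findim_subspaces X" "0 < e"
  then obtain B where B: "finite B" "E = span B" "span B \<subseteq> X" by (auto simp: findim_subspaces_def)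
  define d where "d = min (e / 2) (1 / 2)"
  have d: "0 < d" "2 * d \<le> e" "d < 1" using \<open>0 < e\<close> by (auto simp: d_def)
  obtain n0 where n0: "\<And>n x. n \<ge> n0 \<Longrightarrow> x \<in> span B \<Longrightarrow> N (x - trunc n x) \<le> d * N x"
    using uniform_trunc_approx[OF B(1,3) d(1)] by metis
  define n where "n = max 2 n0"
  have "dist_to_set (\<lambda>x y. ereal (N (x - y))) x (unit_sphere N (coord_space n)) \<le> ereal e"
    if "x \<in> unit_sphere N E" for x
  proof -
    have x: "x \<in> X" "N x = 1" "x \<in> span B" using that B by (auto simp: unit_sphere_def)
    define t where "t = trunc n x"
    have t: "t \<in> X" "t \<in> coord_space n" by (simp_all add: t_def trunc_mem trunc_mem_coord_space)
    have close: "N (x - t) \<le> d" using n0[of n x] x by (simp add: t_def n_def)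
    have Nt: "1 - d \<le> N t" "N t \<le> 1 + d" "0 < N t"
      using norm_diff_ineq[of x t] norm_diff_ineq[of t x] norm_minus_commute[of x t] close x t d
      by linarith+
    define y where "y = inverse (N t) *\<^sub>R t"
    have "y \<in> unit_sphere N (coord_space n)"
      using t Nt(3) by (simp add: unit_sphere_def y_def span_scale norm_scaleR)
    moreover have "N (x - y) \<le> e"
    proof -
      have "t - y = (1 - inverse (N t)) *\<^sub>R t" by (simp add: y_def scaleR_left_diff_distrib)
      then have "N (t - y) = \<bar>1 - inverse (N t)\<bar> * N t" using t by (simp add: norm_scaleR)
      also have "\<dots> = \<bar>(1 - inverse (N t)) * N t\<bar>" using Nt(3) by (simp add: abs_mult)
      also have "(1 - inverse (N t)) * N t = N t - 1" using Nt(3) by (simp add: left_diff_distrib)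
      finally have "N (t - y) \<le> d" using Nt by linarith
      moreover have "y \<in> X" using t by (simp add: y_def mem_intros)
      ultimately show ?thesis using norm_triangle[of x t y] x t close d by linarith
    qed
    ultimately show ?thesis unfolding dist_to_set_def by (intro INF_lower2[of y]) auto
  qed
  then show "\<exists>F\<in>coord_space ` {2..}. subset_eps N e E F"
    unfolding subset_eps_def by (intro bexI[of _ "coord_space n"]) (auto simp: n_def)
qed

end

section \<open>Almost isometric embeddings are almost signed permutations\<close>

locale rigid_orlicz = supermultiplicative_orlicz +
  assumes clarkson: "2 * M \<bar>s\<bar> + 2 * M \<bar>t\<bar> \<le> M \<bar>s + t\<bar> + M \<bar>s - t\<bar>"
    and strict_supermult: "0 < \<epsilon> \<Longrightarrow> \<exists>\<alpha>>1. \<forall>t u. 0 < t \<and> t \<le> 1 - \<epsilon> \<and> 0 < u \<and> u \<le> 1 - \<epsilon> \<longrightarrow>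
      \<alpha> * M t * M u \<le> M (t * u)"
begin

lemma half_point: obtains a where "0 < a" "a < 1" "M a = 1/2"
proof -
  obtain a where a: "0 \<le> a" "a \<le> 1" "M a = 1/2"
    using IVT'[of M 0 "1/2" 1] continuous_on_subset[OF cont, of "{0..1}"] by auto
  then have "a \<noteq> 0" "a \<noteq> 1" by auto
  with a have "0 < a" "a < 1" by linarith+
  then show ?thesis using a(3) by (rule that)
qed

text \<open>Otherwise all \<open>\<bar>x k\<bar> \<le> 1 - d\<close>. By the Clarkson inequality the modulars of \<open>a x\<close> and \<open>a y\<close> add
  up to at most about \<open>1\<close>; but supermultiplicativity bounds that of \<open>a y\<close> below by about
  \<open>M a = 1/2\<close> and, in its strict form, that of \<open>a x\<close> by about \<open>\<alpha> / 2 > 1/2\<close>.\<close>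

lemma large_coordinate:
  assumes a: "0 < a" "M a = 1/2" and d: "0 < d" "a \<le> 1 - d"
  obtains \<theta> where "0 < \<theta>" "\<theta> \<le> 1"
    "\<And>x y. x \<in> X \<Longrightarrow> y \<in> X \<Longrightarrow> N x = 1 \<Longrightarrow> N y = 1 \<Longrightarrow>
       N (a *\<^sub>R (x + y)) \<le> 1 + \<theta> \<Longrightarrow> N (a *\<^sub>R (x - y)) \<le> 1 + \<theta> \<Longrightarrow> \<exists>k. 1 - d < \<bar>x k\<bar>"
proof -
  obtain \<alpha> where "\<alpha> > 1" and \<alpha>: "\<And>t u. 0 < t \<Longrightarrow> t \<le> 1 - d \<Longrightarrow> 0 < u \<Longrightarrow> u \<le> 1 - d
      \<Longrightarrow> \<alpha> * M t * M u \<le> M (t * u)"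
    using strict_supermult[OF d(1)] by blast
  \<comment> \<open>With modular errors \<open>\<theta> K\<close>, the two bounds read
    \<open>\<alpha> / 2 \<cdot> (1 - \<theta> K) + 1/2 \<cdot> (1 - \<theta> K) \<le> 1 + \<theta> K\<close>, that is \<open>\<alpha> - 1 \<le> \<theta> K (\<alpha> + 3)\<close>;
    so \<open>\<theta> K \<le> q\<close> is contradictory.\<close>
  define q where "q = (\<alpha> - 1) / 2 / (\<alpha> + 3)"
  have "q * (\<alpha> + 3) = (\<alpha> - 1) / 2"
    unfolding q_def by (rule nonzero_eq_divide_eq[THEN iffD1]) (use \<open>\<alpha> > 1\<close> in auto)
  then have q: "0 < q" "q * (\<alpha> + 3) < \<alpha> - 1" using \<open>\<alpha> > 1\<close> by (simp_all add: q_def)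
  define \<theta> where "\<theta> = min 1 (q / (K + 1))"
  have \<theta>: "0 < \<theta>" "\<theta> \<le> 1" using q K_nonneg by (auto simp: \<theta>_def)
  have "\<theta> * K \<le> q / (K + 1) * (K + 1)"
    using q K_nonneg by (intro mult_mono) (auto simp: \<theta>_def)
  then have \<theta>K: "\<theta> * K \<le> q" "0 \<le> \<theta> * K" using K_nonneg \<theta> by auto
  have "\<exists>k. 1 - d < \<bar>x k\<bar>"
    if mem: "x \<in> X" "y \<in> X" and one: "N x = 1" "N y = 1"
      and sum: "N (a *\<^sub>R (x + y)) \<le> 1 + \<theta>" and diff: "N (a *\<^sub>R (x - y)) \<le> 1 + \<theta>" for x y
  proof (rule ccontr)
    assume "\<not> (\<exists>k. 1 - d < \<bar>x k\<bar>)"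
    then have flat: "\<bar>x k\<bar> \<le> 1 - d" for k by (meson not_le)
    obtain F1 where F1: "finite F1" "1 < (1 + \<theta> * K) * (\<Sum>k\<in>F1. M \<bar>x k\<bar>)"
      using modular_gt_if_norm_eq_one[OF mem(1) one(1) \<theta>] by blast
    obtain F2 where F2: "finite F2" "1 < (1 + \<theta> * K) * (\<Sum>k\<in>F2. M \<bar>y k\<bar>)"
      using modular_gt_if_norm_eq_one[OF mem(2) one(2) \<theta>] by blast
    define F where "F = F1 \<union> F2"
    have F: "finite F" using F1 F2 by (simp add: F_def)
    define A where "A = (\<Sum>k\<in>F. M \<bar>x k\<bar>)"
    define B where "B = (\<Sum>k\<in>F. M \<bar>y k\<bar>)"
    have "(\<Sum>k\<in>F1. M \<bar>x k\<bar>) \<le> A" "(\<Sum>k\<in>F2. M \<bar>y k\<bar>) \<le> B"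
      unfolding A_def B_def using F by (auto intro!: sum_mono2 simp: F_def)
    then have "(1 + \<theta> * K) * (\<Sum>k\<in>F1. M \<bar>x k\<bar>) \<le> (1 + \<theta> * K) * A"
      "(1 + \<theta> * K) * (\<Sum>k\<in>F2. M \<bar>y k\<bar>) \<le> (1 + \<theta> * K) * B"
      using \<theta>K by (auto intro!: mult_left_mono)
    then have AB: "1 < (1 + \<theta> * K) * A" "1 < (1 + \<theta> * K) * B" using F1 F2 by linarith+
    have ax: "\<alpha> / 2 * A \<le> (\<Sum>k\<in>F. M \<bar>a * x k\<bar>)"
      unfolding A_def sum_distrib_left
    proof (rule sum_mono)
      fix k
      show "\<alpha> / 2 * M \<bar>x k\<bar> \<le> M \<bar>a * x k\<bar>"
        using \<alpha>[of a "\<bar>x k\<bar>"] flat[of k] a d by (cases "x k = 0") (simp_all add: abs_mult)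
    qed
    have ay: "1 / 2 * B \<le> (\<Sum>k\<in>F. M \<bar>a * y k\<bar>)"
      unfolding B_def sum_distrib_left
    proof (rule sum_mono)
      fix k
      show "1 / 2 * M \<bar>y k\<bar> \<le> M \<bar>a * y k\<bar>"
        using supermult[of a "\<bar>y k\<bar>"] abs_le_norm[OF mem(2), of k] one a d by (simp add: abs_mult)
    qed
    have "2 * (\<Sum>k\<in>F. M \<bar>a * x k\<bar>) + 2 * (\<Sum>k\<in>F. M \<bar>a * y k\<bar>)
        \<le> (\<Sum>k\<in>F. M \<bar>(a *\<^sub>R (x + y)) k\<bar>) + (\<Sum>k\<in>F. M \<bar>(a *\<^sub>R (x - y)) k\<bar>)"
      unfolding sum_distrib_left sum.distrib[symmetric] using clarkson
      by (intro sum_mono) (simp add: scaleR_fun_def distrib_left right_diff_distrib)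
    also have "\<dots> \<le> (1 + \<theta> * K) + (1 + \<theta> * K)"
      using mem \<theta> F sum diff by (intro add_mono modular_le_if_norm_le mem_intros) auto
    finally have total: "\<alpha> / 2 * A + 1 / 2 * B \<le> 1 + \<theta> * K" using ax ay by linarith
    have "1 - \<theta> * K \<le> A" "1 - \<theta> * K \<le> B"
    proof -
      have "1 - \<theta> * K \<le> C" if "1 < (1 + \<theta> * K) * C" for C
      proof (rule ccontr)
        assume "\<not> 1 - \<theta> * K \<le> C"
        then have "(1 + \<theta> * K) * C \<le> (1 + \<theta> * K) * (1 - \<theta> * K)" using \<theta>K by (intro mult_left_mono) auto
        also have "\<dots> \<le> 1" using zero_le_square[of "\<theta> * K"] by (simp add: algebra_simps)
        finally show False using that by simp
      qed
      with AB show "1 - \<theta> * K \<le> A" "1 - \<theta> * K \<le> B" by blast+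
    qed
    then have "\<alpha> / 2 * (1 - \<theta> * K) + 1 / 2 * (1 - \<theta> * K) \<le> \<alpha> / 2 * A + 1 / 2 * B"
      using \<open>\<alpha> > 1\<close> by (intro add_mono mult_left_mono) auto
    with total have "\<alpha> - 1 \<le> (\<theta> * K) * (\<alpha> + 3)" by (simp add: algebra_simps)
    also have "\<dots> \<le> q * (\<alpha> + 3)" using \<theta>K \<open>\<alpha> > 1\<close> by (intro mult_right_mono) auto
    finally show False using q by simp
  qed
  with \<theta> that show ?thesis by blast
qed

text \<open>The \<open>k\<close>-th coordinate takes up at least \<open>M(1 - d)\<close> of the modular of \<open>x\<close>, which is at most \<open>1\<close>,
  so the modular of the rest is at most \<open>M e\<close>, and its norm at most \<open>e\<close>. Replacing \<open>x k\<close> by its sign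
  costs another \<open>d \<le> e\<close>.\<close>

lemma near_unit_if_large_coordinate:
  assumes e: "0 < e" "e \<le> 1" and d: "0 \<le> d" "d < 1" "d \<le> e" "1 - M (1 - d) \<le> M e"
    and x: "x \<in> X" "N x = 1" "1 - d < \<bar>x k\<bar>"
  shows "N (x - sgn (x k) *\<^sub>R unit_seq k) \<le> 2 * e"
proof -
  define w where "w = x - x k *\<^sub>R unit_seq k"
  have w: "w j = (if j = k then 0 else x j)" for j
    by (simp add: w_def scaleR_fun_def unit_seq_def)
  have "(\<Sum>j\<in>F. M \<bar>w j\<bar>) \<le> M e" if "finite F" for F
  proof -
    have "(\<Sum>j\<in>F. M \<bar>w j\<bar>) = (\<Sum>j\<in>F - {k}. M \<bar>x j\<bar>)"
      using that by (intro sum.mono_neutral_cong_right) (auto simp: w)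
    moreover have "M \<bar>x k\<bar> + (\<Sum>j\<in>F - {k}. M \<bar>x j\<bar>) \<le> 1"
      using norm_leD[of x 1 "insert k F"] x that by (simp add: sum.insert_remove)
    moreover have "M (1 - d) \<le> M \<bar>x k\<bar>" using x d by (intro mono) auto
    ultimately show ?thesis using d by linarith
  qed
  then have w_le: "w \<in> X" "N w \<le> e" using norm_le_if_modular_le[OF e, of w] by blast+
  have "x k \<noteq> 0" using x d by auto
  then have "\<bar>x k - sgn (x k)\<bar> = 1 - \<bar>x k\<bar>" using abs_le_norm[OF x(1), of k] x(2)
    by (auto simp: sgn_if split: if_splits)
  then have "N ((x k - sgn (x k)) *\<^sub>R unit_seq k) \<le> e"
    using x d by (simp add: norm_scaleR unit_seq_mem)
  moreover have "x - sgn (x k) *\<^sub>R unit_seq k = w + (x k - sgn (x k)) *\<^sub>R unit_seq k"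
    by (simp add: w_def scaleR_left_diff_distrib)
  ultimately show ?thesis
    using add_mem_le(2)[of w "(x k - sgn (x k)) *\<^sub>R unit_seq k"] w_le by (simp add: mem_intros unit_seq_mem)
qed

lemma norm_two_units_le:
  assumes "M a = 1/2" "0 < r" "i \<noteq> j" "0 \<le> a" "\<bar>b\<bar> \<le> a * r" "\<bar>c\<bar> \<le> a * r"
  shows "N (b *\<^sub>R unit_seq i + c *\<^sub>R unit_seq j) \<le> r"
proof (rule norm_leI(2)[OF \<open>0 < r\<close>])
  fix F :: "nat set" assume "finite F"
  let ?x = "b *\<^sub>R unit_seq i + c *\<^sub>R unit_seq j"
  have "M (\<bar>?x k\<bar> / r) \<le> (if k = i then 1/2 else 0) + (if k = j then 1/2 else 0)" for k
  proof -
    have "M (\<bar>b\<bar> / r) \<le> M a" "M (\<bar>c\<bar> / r) \<le> M a"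
      using assms by (auto intro!: mono simp: field_simps)
    then show ?thesis using assms by (auto simp: scaleR_fun_def unit_seq_def)
  qed
  then have "(\<Sum>k\<in>F. M (\<bar>?x k\<bar> / r)) \<le> (\<Sum>k\<in>F. (if k = i then 1/2 else 0) + (if k = j then 1/2 else 0))"
    by (intro sum_mono)
  also have "\<dots> \<le> 1" using \<open>finite F\<close> by (simp add: sum.distrib)
  finally show "(\<Sum>k\<in>F. M (\<bar>?x k\<bar> / r)) \<le> 1" .
qed

text \<open>The two operator norm bounds in the definition of \<open>Emb\<close>, stated for single vectors.\<close>

definition near_isometry :: "real \<Rightarrow> nat \<Rightarrow> ((nat \<Rightarrow> real) \<Rightarrow> nat \<Rightarrow> real) \<Rightarrow> bool" where
  "near_isometry C n T \<longleftrightarrow> linear_map_on (coord_space n) T \<and>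
     (\<forall>x\<in>coord_space n. T x \<in> X \<and> N (T x) \<le> C * N x \<and> N x \<le> C * N (T x))"

text \<open>As \<open>n \<ge> 2\<close>, there is a second index \<open>j \<noteq> i\<close>. The normalised images of \<open>e\<^sub>i\<close> and \<open>e\<^sub>j\<close> satisfy the
  premises of \<open>large_coordinate\<close> up to a factor \<open>(1 + \<delta>)\<^sup>2\<close>, one factor \<open>1 + \<delta>\<close> being due to the
  embedding and one to the normalisation.\<close>

lemma near_isometry_unit:
  assumes "0 < e" "2 \<le> n"
  obtains \<delta> where "0 < \<delta>" "\<delta> \<le> 1"
    "\<And>T i. near_isometry (1 + \<delta>) n T \<Longrightarrow> i < n \<Longrightarrow>
       \<exists>k s. \<bar>s\<bar> = 1 \<and> N (T (unit_seq i) - s *\<^sub>R unit_seq k) \<le> e"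
proof -
  define e1 where "e1 = min 1 (e / 4)"
  have e1: "0 < e1" "e1 \<le> 1" "4 * e1 \<le> e" using \<open>0 < e\<close> by (auto simp: e1_def)
  obtain a where a: "0 < a" "a < 1" "M a = 1/2" by (rule half_point)
  have "continuous_on {0..1} (\<lambda>d. M (1 - d))"
    by (intro continuous_on_compose2[OF cont] continuous_intros) auto
  then have "((\<lambda>d. M (1 - d)) \<longlongrightarrow> M (1 - 0)) (at 0 within {0..1})"
    unfolding continuous_on_def by (rule bspec) simp
  then have "((\<lambda>d. M (1 - d)) \<longlongrightarrow> 1) (at_right 0)"
    by (simp add: at_within_Icc_at_right)
  then have "\<forall>\<^sub>F d in at_right 0. 1 - M e1 < M (1 - d)"
    by (rule order_tendstoD) (simp add: pos e1)
  then obtain b where b: "b > 0" "\<And>d. 0 < d \<Longrightarrow> d < b \<Longrightarrow> 1 - M e1 < M (1 - d)"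
    unfolding eventually_at_right_field by blast
  define d where "d = min (b / 2) (min e1 (1 - a))"
  have d: "0 < d" "d \<le> e1" "d < 1" "a \<le> 1 - d" and "d < b" using b e1 a by (auto simp: d_def)
  then have d': "1 - M (1 - d) \<le> M e1" using b(2)[of d] by simp
  obtain \<theta> where \<theta>: "0 < \<theta>" "\<theta> \<le> 1" and large: "\<And>x y. x \<in> X \<Longrightarrow> y \<in> X \<Longrightarrow> N x = 1 \<Longrightarrow> N y = 1 \<Longrightarrow>
       N (a *\<^sub>R (x + y)) \<le> 1 + \<theta> \<Longrightarrow> N (a *\<^sub>R (x - y)) \<le> 1 + \<theta> \<Longrightarrow> \<exists>k. 1 - d < \<bar>x k\<bar>"
    using large_coordinate[OF a(1,3) d(1,4)] by blast
  define \<delta> where "\<delta> = min (\<theta> / 3) e1"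
  have \<delta>: "0 < \<delta>" "\<delta> \<le> 1" "3 * \<delta> \<le> \<theta>" "\<delta> \<le> e1" using \<theta> e1 by (auto simp: \<delta>_def)
  have sq: "(1 + \<delta>) * (1 + \<delta>) \<le> 1 + \<theta>"
  proof -
    have "\<delta> * \<delta> \<le> \<delta>" using mult_left_mono[of \<delta> 1 \<delta>] \<delta> by simp
    moreover have "(1 + \<delta>) * (1 + \<delta>) = 1 + 2 * \<delta> + \<delta> * \<delta>" by (simp add: algebra_simps)
    ultimately show ?thesis using \<delta>(3) by linarith
  qed
  have "\<exists>k s. \<bar>s\<bar> = 1 \<and> N (T (unit_seq i) - s *\<^sub>R unit_seq k) \<le> e"
    if T: "near_isometry (1 + \<delta>) n T" and "i < n" for T i
  proof -
    define j where "j = (if i = 0 then 1 else 0 :: nat)"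
    have j: "j < n" "i \<noteq> j" using \<open>2 \<le> n\<close> by (auto simp: j_def)
    have unit: "unit_seq i \<in> coord_space n" "unit_seq j \<in> coord_space n"
      using \<open>i < n\<close> j by (auto intro: span_base)
    define x y where "x = T (unit_seq i)" and "y = T (unit_seq j)"
    have mem: "x \<in> X" "y \<in> X" using T unit by (auto simp: near_isometry_def x_def y_def)
    have "N x \<le> (1 + \<delta>) * N (unit_seq i)" "N (unit_seq i) \<le> (1 + \<delta>) * N x"
         "N (unit_seq j) \<le> (1 + \<delta>) * N y"
      using T unit unfolding near_isometry_def x_def y_def by blast+
    then have Nx: "N x \<le> 1 + \<delta>" "1 \<le> (1 + \<delta>) * N x" "1 \<le> (1 + \<delta>) * N y" by simp_all
    have pos: "0 < N x" "0 < N y" using Nx norm_nonneg[of x] norm_nonneg[of y]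
      by (metis less_eq_real_def mult_zero_right not_one_le_zero)+
    have inv: "inverse (N x) \<le> 1 + \<delta>" "inverse (N y) \<le> 1 + \<delta>"
      using Nx pos by (simp_all add: inverse_eq_divide pos_divide_le_eq)
    define x' y' where "x' = inverse (N x) *\<^sub>R x" and "y' = inverse (N y) *\<^sub>R y"
    have mem': "x' \<in> X" "y' \<in> X" and one: "N x' = 1" "N y' = 1"
      using mem pos by (simp_all add: x'_def y'_def mem_intros norm_scaleR)
    have lin: "N (b *\<^sub>R x + c *\<^sub>R y) \<le> 1 + \<theta>" if "\<bar>b\<bar> \<le> a * (1 + \<delta>)" "\<bar>c\<bar> \<le> a * (1 + \<delta>)" for b c
    proof -
      let ?u = "b *\<^sub>R unit_seq i + c *\<^sub>R unit_seq j"
      have "?u \<in> coord_space n" using unit by (intro span_add span_scale)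
      then have "N (T ?u) \<le> (1 + \<delta>) * N ?u" using T by (simp add: near_isometry_def)
      also have "\<dots> \<le> (1 + \<delta>) * (1 + \<delta>)"
        using \<delta> a j that by (intro mult_left_mono norm_two_units_le[of a]) auto
      also note sq
      also have "T ?u = b *\<^sub>R x + c *\<^sub>R y"
        using T unit by (simp add: near_isometry_def linear_map_on_def x_def y_def span_scale)
      finally show ?thesis .
    qed
    have coeff: "\<bar>a * inverse (N x)\<bar> \<le> a * (1 + \<delta>)" "\<bar>a * inverse (N y)\<bar> \<le> a * (1 + \<delta>)"
      using a pos inv by (simp_all add: abs_mult)
    have plus: "N (a *\<^sub>R (x' + y')) \<le> 1 + \<theta>"
    proof -
      have "a *\<^sub>R (x' + y') = (a * inverse (N x)) *\<^sub>R x + (a * inverse (N y)) *\<^sub>R y"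
        by (simp add: x'_def y'_def scaleR_right_distrib)
      then show ?thesis using lin[OF coeff] by simp
    qed
    have minus: "N (a *\<^sub>R (x' - y')) \<le> 1 + \<theta>"
    proof -
      have "a *\<^sub>R (x' - y') = (a * inverse (N x)) *\<^sub>R x + (- (a * inverse (N y))) *\<^sub>R y"
        by (simp add: x'_def y'_def scaleR_right_diff_distrib)
      then show ?thesis using lin[of "a * inverse (N x)" "- (a * inverse (N y))"] coeff by simp
    qed
    obtain k where k: "1 - d < \<bar>x' k\<bar>" using large[OF mem' one plus minus] by blast
    have "N (x' - sgn (x' k) *\<^sub>R unit_seq k) \<le> 2 * e1"
      by (rule near_unit_if_large_coordinate[where d = d]) (use e1 d d' mem' one k in auto)
    moreover have "N (x - x') \<le> \<delta>"
    proof -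
      have "x - x' = (N x - 1) *\<^sub>R x'"
        using pos by (simp add: x'_def scaleR_left_diff_distrib left_diff_distrib)
      then have "N (x - x') = \<bar>N x - 1\<bar>" using mem' one by (simp add: norm_scaleR)
      moreover have "1 - \<delta> \<le> N x"
      proof -
        have "(1 + \<delta>) * (1 - \<delta>) \<le> 1" by (simp add: algebra_simps)
        then have "(1 + \<delta>) * (1 - \<delta>) \<le> (1 + \<delta>) * N x" using Nx by linarith
        then show ?thesis using \<delta> by simp
      qed
      ultimately show ?thesis using Nx by linarith
    qed
    ultimately have "N (x - sgn (x' k) *\<^sub>R unit_seq k) \<le> e"
      using norm_triangle[of x x' "sgn (x' k) *\<^sub>R unit_seq k"] mem mem' e1 \<delta>
      by (simp add: mem_intros unit_seq_mem)
    moreover have "\<bar>sgn (x' k)\<bar> = 1" using k d by (auto simp: abs_sgn_eq)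
    ultimately show ?thesis unfolding x_def by blast
  qed
  with \<delta> that show ?thesis by blast
qed

end

section \<open>Signed permutations\<close>

text \<open>The images of \<open>A\<close> have equal size, hence so have their complements in the union \<open>S\<close> of the two
  images; outside of \<open>S\<close> the extension is the identity.\<close>

lemma ex_bij_extension:
  fixes f g :: "'a \<Rightarrow> 'b"
  assumes "finite A" "inj_on f A" "inj_on g A"
  obtains \<pi> where "bij \<pi>" "\<And>i. i \<in> A \<Longrightarrow> \<pi> (f i) = g i"
proof -
  define S where "S = f ` A \<union> g ` A"
  have "card (S - f ` A) = card (S - g ` A)"
    using assms by (subst (1 2) card_Diff_subset) (auto simp: S_def card_image)
  then obtain h where h: "bij_betw h (S - f ` A) (S - g ` A)"
    using finite_same_card_bij[of "S - f ` A" "S - g ` A"] assms(1) by (auto simp: S_def)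
  define \<phi> where "\<phi> = g \<circ> the_inv_into A f"
  have \<phi>: "bij_betw \<phi> (f ` A) (g ` A)"
    unfolding \<phi>_def using assms
    by (intro bij_betw_trans[OF bij_betw_the_inv_into]) (auto simp: bij_betw_def)
  have "bij_betw (\<lambda>x. if x \<in> f ` A then \<phi> x else h x) (f ` A \<union> (S - f ` A)) (g ` A \<union> (S - g ` A))"
    by (rule bij_betw_disjoint_Un[OF \<phi> h]) auto
  moreover have "f ` A \<union> (S - f ` A) = S" "g ` A \<union> (S - g ` A) = S" by (auto simp: S_def)
  ultimately have "bij_betw (\<lambda>x. if x \<in> f ` A then \<phi> x else h x) S S" by simp
  then have "bij_betw (\<lambda>x. if x \<in> S then if x \<in> f ` A then \<phi> x else h x else id x) (S \<union> - S) (S \<union> - S)"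
    by (rule bij_betw_disjoint_Un[OF _ bij_betw_id]) auto
  then have "bij (\<lambda>x. if x \<in> S then if x \<in> f ` A then \<phi> x else h x else id x)" by simp
  moreover have "\<phi> (f i) = g i" if "i \<in> A" for i
    using assms that by (simp add: \<phi>_def the_inv_into_f_f)
  ultimately show ?thesis
    by (intro that[of "\<lambda>x. if x \<in> S then if x \<in> f ` A then \<phi> x else h x else id x"]) (auto simp: S_def)
qed

lemma linear_map_on_sum:
  assumes "subspace E" "linear_map_on E L" "finite I" "\<And>i. i \<in> I \<Longrightarrow> f i \<in> E"
  shows "L (\<Sum>i\<in>I. f i) = (\<Sum>i\<in>I. L (f i))"
  using assms(3,4)
proof (induction I rule: finite_induct)
  case empty
  have "L (0 *\<^sub>R 0) = 0 *\<^sub>R L 0"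
    using assms(1,2) unfolding linear_map_on_def by (metis subspace_0)
  then show ?case by simp
next
  case (insert i I)
  then have "L (f i + sum f I) = L (f i) + L (sum f I)"
    using assms(1,2) by (simp add: linear_map_on_def subspace_sum)
  with insert show ?case by (simp only: sum.insert[OF insert(1,2)]) simp
qed

context normalised_orlicz begin

definition signed_permutation ::
  "(nat \<Rightarrow> real) \<Rightarrow> (nat \<Rightarrow> nat) \<Rightarrow> (nat \<Rightarrow> real) \<Rightarrow> nat \<Rightarrow> real" where
  "signed_permutation c \<pi> = (\<lambda>x\<in>X. \<lambda>k. c k * x (\<pi> k))"

lemma rearrange_le:
  assumes "inj \<pi>" "\<And>k. \<bar>c k\<bar> = 1" "x \<in> X"
  shows "(\<lambda>k. c k * x (\<pi> k)) \<in> X" "N (\<lambda>k. c k * x (\<pi> k)) \<le> N x"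
proof -
  let ?y = "\<lambda>k. c k * x (\<pi> k)"
  have *: "?y \<in> X \<and> N ?y \<le> r" if "N x < r" for r
  proof -
    have "r > 0" using that norm_nonneg[of x] by linarith
    have "(\<Sum>k\<in>F. M (\<bar>?y k\<bar> / r)) \<le> 1" if "finite F" for F
    proof -
      have "(\<Sum>k\<in>F. M (\<bar>?y k\<bar> / r)) = (\<Sum>k\<in>\<pi> ` F. M (\<bar>x k\<bar> / r))"
        using assms inj_on_subset[OF \<open>inj \<pi>\<close>] by (subst sum.reindex) (auto simp: abs_mult)
      also have "\<dots> \<le> 1" using assms that \<open>N x < r\<close> \<open>r > 0\<close> by (intro norm_leD) auto
      finally show ?thesis .
    qed
    with norm_leI[of r ?y] \<open>r > 0\<close> show ?thesis by blast
  qed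
  show "?y \<in> X" using *[of "N x + 1"] by simp
  show "N ?y \<le> N x"
  proof (rule field_le_epsilon)
    fix e :: real assume "0 < e"
    then show "N ?y \<le> N x + e" using *[of "N x + e"] by simp
  qed
qed

lemma signed_permutation_Iso:
  assumes "bij \<pi>" and c: "\<And>k. \<bar>c k\<bar> = 1"
  shows "signed_permutation c \<pi> \<in> Iso X N"
proof -
  let ?g = "signed_permutation c \<pi>"
  let ?p = "inv \<pi>"
  let ?h = "\<lambda>x k. c (?p k) * x (?p k)"
  have inj: "inj \<pi>" "inj ?p" using \<open>bij \<pi>\<close> by (auto simp: bij_is_inj bij_imp_bij_inv)
  have p: "?p (\<pi> k) = k" "\<pi> (?p k) = k" for k using \<open>bij \<pi>\<close> by (auto simp: bij_is_inj bij_is_surj surj_f_inv_f)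
  have cc: "c k * c k = 1" for k using c[of k] by (metis abs_mult_self_eq mult_1)
  have g: "?g x = (\<lambda>k. c k * x (\<pi> k))" if "x \<in> X" for x using that by (simp add: signed_permutation_def)
  have mem: "?g x \<in> X" "N (?g x) \<le> N x" if "x \<in> X" for x
    using rearrange_le[of \<pi> c, OF inj(1) c that] by (simp_all add: g that)
  have h: "?h x \<in> X" "N (?h x) \<le> N x" if "x \<in> X" for x
    using rearrange_le[of ?p "\<lambda>k. c (?p k)", OF inj(2) c that] by simp_all
  have hg: "?h (?g x) = x" if "x \<in> X" for x
    using cc p by (simp add: g[OF that] fun_eq_iff mult.assoc[symmetric])
  have gh: "?g (?h x) = x" if "x \<in> X" for x
    using cc p by (simp add: g[OF h(1)[OF that]] fun_eq_iff mult.assoc[symmetric])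
  show ?thesis unfolding Iso_def
  proof (intro CollectI conjI)
    show "?g \<in> X \<rightarrow>\<^sub>E X" using mem by (auto simp: signed_permutation_def)
    show "linear_map_on X ?g"
      unfolding linear_map_on_def
    proof (intro conjI ballI allI)
      fix x y assume xy: "x \<in> X" "y \<in> X"
      show "?g (x + y) = ?g x + ?g y"
        unfolding g[OF xy(1)] g[OF xy(2)] g[OF add_mem_le(1)[OF xy]]
        by (simp add: fun_eq_iff distrib_left)
    next
      fix a x assume x: "x \<in> X"
      show "?g (a *\<^sub>R x) = a *\<^sub>R ?g x"
        unfolding g[OF x] g[OF scaleR_mem_le(1)[OF x]] by (simp add: fun_eq_iff scaleR_fun_def)
    qed
    show "?g ` X = X"
    proof (intro equalityI subsetI)
      fix x assume x: "x \<in> X"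
      show "x \<in> ?g ` X" by (rule image_eqI[where x = "?h x"]) (simp_all only: gh[OF x] h(1)[OF x])
    qed (use mem(1) in blast)
    show "\<forall>x\<in>X. N (?g x) = N x"
    proof
      fix x assume x: "x \<in> X"
      have "N x \<le> N (?g x)" using h(2)[OF mem(1)[OF x]] by (simp only: hg[OF x])
      with mem(2)[OF x] show "N (?g x) = N x" by simp
    qed
  qed
qed

lemma signed_permutation_unit_seq:
  assumes "bij \<pi>" "\<pi> l = k"
  shows "signed_permutation c \<pi> (unit_seq k) = c l *\<^sub>R unit_seq l"
proof
  fix j
  have "\<pi> j = k \<longleftrightarrow> j = l" using assms by (auto simp: bij_def inj_eq)
  then show "signed_permutation c \<pi> (unit_seq k) j = (c l *\<^sub>R unit_seq l) j"
    by (simp add: signed_permutation_def unit_seq_mem) (simp add: unit_seq_def scaleR_fun_def)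
qed

end

section \<open>Approximate transitivity\<close>

context rigid_orlicz begin

lemma Emb_near_isometry:
  assumes T: "T \<in> Emb X N C (coord_space n)"
  shows "near_isometry C n T"
  unfolding near_isometry_def
proof (intro conjI ballI)
  let ?E = "coord_space n"
  show lin: "linear_map_on ?E T" using T by (simp add: Emb_def)
  have maps: "\<And>x. x \<in> ?E \<Longrightarrow> T x \<in> X" and inj: "inj_on T ?E"
    and bound: "opnorm N ?E T \<le> ereal C" "opnorm N (T ` ?E) (inv_into ?E T) \<le> ereal C"
    using T by (auto simp: Emb_def)
  have scale: "T (c *\<^sub>R x) = c *\<^sub>R T x" if "x \<in> ?E" for c x
    using lin that by (simp add: linear_map_on_def)
  have "T 0 = 0" using scale[of 0 0] by (simp add: span_zero)
  fix x assume x: "x \<in> ?E"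
  then have xX: "x \<in> X" using coord_space_subset by blast
  show TX: "T x \<in> X" using maps x by blast
  have unit: "N (T y) \<le> C" if "y \<in> ?E" "N y \<le> 1" for y
  proof -
    have "ereal (N (T y)) \<le> opnorm N ?E T" unfolding opnorm_def using that by (intro SUP_upper) auto
    with bound(1) have "ereal (N (T y)) \<le> ereal C" by (rule order_trans[rotated])
    then show ?thesis by simp
  qed
  have unit': "N y \<le> C" if "y \<in> ?E" "N (T y) \<le> 1" for y
  proof -
    have "ereal (N (inv_into ?E T (T y))) \<le> opnorm N (T ` ?E) (inv_into ?E T)"
      unfolding opnorm_def using that by (intro SUP_upper) auto
    with bound(2) have "ereal (N (inv_into ?E T (T y))) \<le> ereal C" by (rule order_trans[rotated])
    then show ?thesis using inj that by simp
  qed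
  show "N (T x) \<le> C * N x"
  proof (cases "x = 0")
    case True
    then show ?thesis using \<open>T 0 = 0\<close> by simp
  next
    case False
    then have pos: "0 < N x" using norm_eq_zero_iff[OF xX] norm_nonneg[of x] by linarith
    have "N (T (inverse (N x) *\<^sub>R x)) \<le> C"
      using pos by (intro unit span_scale x) (simp add: norm_scaleR xX)
    then have "inverse (N x) * N (T x) \<le> C"
      using pos by (simp add: scale[OF x] norm_scaleR TX)
    then show ?thesis using pos by (simp add: field_simps)
  qed
  show "N x \<le> C * N (T x)"
  proof (cases "x = 0")
    case True
    then show ?thesis using \<open>T 0 = 0\<close> by simp
  next
    case False
    then have "T x \<noteq> 0" using inj x \<open>T 0 = 0\<close> by (metis inj_onD span_zero)
    then have pos: "0 < N (T x)" using norm_eq_zero_iff[OF TX] norm_nonneg[of "T x"] by linarith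
    have "N (inverse (N (T x)) *\<^sub>R x) \<le> C"
      using pos by (intro unit' span_scale x) (simp add: scale[OF x] norm_scaleR TX)
    then have "inverse (N (T x)) * N x \<le> C"
      using pos by (simp add: norm_scaleR xX)
    then show ?thesis using pos by (simp add: field_simps)
  qed
qed

text \<open>If \<open>e\<^sub>i\<close> and \<open>e\<^sub>j\<close> were mapped close to multiples of the same unit vector, some \<open>e\<^sub>i \<mp> e\<^sub>j\<close>, whose
  norm is at least \<open>1\<close>, would have a small image.\<close>

lemma near_isometry_distinct:
  assumes T: "near_isometry (1 + \<delta>) n T" and "\<delta> \<le> 1" "\<eta> \<le> 1 / 8"
    and close: "\<And>i. i < n \<Longrightarrow> \<bar>s i\<bar> = 1 \<and> N (T (unit_seq i) - s i *\<^sub>R unit_seq (\<kappa> i)) \<le> \<eta>"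
  shows "inj_on \<kappa> {..<n}"
proof (rule inj_onI, rule ccontr)
  fix i j assume ij: "i \<in> {..<n}" "j \<in> {..<n}" "\<kappa> i = \<kappa> j" "i \<noteq> j"
  let ?E = "coord_space n"
  have unit: "unit_seq i \<in> ?E" "unit_seq j \<in> ?E" using ij by (auto intro: span_base)
  let ?a = "T (unit_seq i) - s i *\<^sub>R unit_seq (\<kappa> i)" and ?b = "T (unit_seq j) - s j *\<^sub>R unit_seq (\<kappa> j)"
  define t where "t = s i * s j"
  have t: "\<bar>t\<bar> = 1" "t * s j = s i"
    using close[of i] close[of j] ij abs_mult_self_eq[of "s j"] by (auto simp: t_def abs_mult mult.assoc)
  have mem: "T (unit_seq i) \<in> X" "T (unit_seq j) \<in> X" "?a \<in> X" "?b \<in> X"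
    using T unit by (auto simp: near_isometry_def intro!: subspace_diff[OF subspace_space] mem_intros unit_seq_mem)
  define u where "u = unit_seq i - t *\<^sub>R unit_seq j"
  have u: "u \<in> ?E" unfolding u_def using unit by (intro span_diff span_scale)
  have "1 = \<bar>u i\<bar>" using ij by (simp add: u_def scaleR_fun_def) (simp add: unit_seq_def)
  also have "\<dots> \<le> N u" using u coord_space_subset by (intro abs_le_norm) auto
  also have "\<dots> \<le> (1 + \<delta>) * N (T u)" using T u by (simp add: near_isometry_def)
  also have "\<dots> \<le> 2 * N (T u)" using \<open>\<delta> \<le> 1\<close> by (intro mult_right_mono) auto
  finally have "1 \<le> 2 * N (T u)" .
  have lin: "T (x + y) = T x + T y" "T (c *\<^sub>R x) = c *\<^sub>R T x" if "x \<in> ?E" "y \<in> ?E" for x y c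
    using T that by (auto simp: near_isometry_def linear_map_on_def)
  have "T u = T (unit_seq i + (- t) *\<^sub>R unit_seq j)" by (simp add: u_def)
  also have "\<dots> = T (unit_seq i) + (- t) *\<^sub>R T (unit_seq j)"
    using lin(1)[OF unit(1) span_scale[OF unit(2), of "- t"]] lin(2)[OF unit(2,2), of "- t"] by simp
  also have "\<dots> = ?a + (- t) *\<^sub>R ?b"
    using ij t by (simp add: scaleR_right_diff_distrib)
  finally have "N (T u) \<le> N ?a + N ((- t) *\<^sub>R ?b)"
    using add_mem_le(2)[OF mem(3) subspace_scale[OF subspace_space mem(4)], of "- t"] by simp
  also have "\<dots> = N ?a + N ?b" using t norm_scaleR[OF mem(4), of "- t"] by simp
  also have "\<dots> \<le> \<eta> + \<eta>" using close[of i] close[of j] ij by (intro add_mono) auto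
  finally show False using \<open>1 \<le> 2 * N (T u)\<close> \<open>\<eta> \<le> 1 / 8\<close> by linarith
qed

lemma near_isometry_signed_permutation:
  assumes "0 < \<eta>" "2 \<le> n"
  obtains \<delta> where "0 < \<delta>" "\<And>T. near_isometry (1 + \<delta>) n T \<Longrightarrow>
    \<exists>\<kappa> s. inj_on \<kappa> {..<n} \<and> (\<forall>i<n. \<bar>s i\<bar> = 1 \<and> N (T (unit_seq i) - s i *\<^sub>R unit_seq (\<kappa> i)) \<le> \<eta>)"
proof -
  define \<eta>' where "\<eta>' = min \<eta> (1 / 8)"
  have \<eta>': "0 < \<eta>'" "\<eta>' \<le> \<eta>" "\<eta>' \<le> 1 / 8" using \<open>0 < \<eta>\<close> by (auto simp: \<eta>'_def)
  obtain \<delta> where \<delta>: "0 < \<delta>" "\<delta> \<le> 1" and near: "\<And>T i. near_isometry (1 + \<delta>) n T \<Longrightarrow> i < n \<Longrightarrow>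
       \<exists>k s. \<bar>s\<bar> = 1 \<and> N (T (unit_seq i) - s *\<^sub>R unit_seq k) \<le> \<eta>'"
    using near_isometry_unit[OF \<eta>'(1) \<open>2 \<le> n\<close>] by blast
  have "\<exists>\<kappa> s. inj_on \<kappa> {..<n} \<and> (\<forall>i<n. \<bar>s i\<bar> = 1 \<and> N (T (unit_seq i) - s i *\<^sub>R unit_seq (\<kappa> i)) \<le> \<eta>)"
    if T: "near_isometry (1 + \<delta>) n T" for T
  proof -
    obtain \<kappa> s where close: "\<And>i. i < n \<Longrightarrow> \<bar>s i\<bar> = 1 \<and> N (T (unit_seq i) - s i *\<^sub>R unit_seq (\<kappa> i)) \<le> \<eta>'"
      using near[OF T] by metis
    have "inj_on \<kappa> {..<n}" by (rule near_isometry_distinct[OF T \<delta>(2) \<eta>'(3) close])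
    moreover have "\<forall>i<n. \<bar>s i\<bar> = 1 \<and> N (T (unit_seq i) - s i *\<^sub>R unit_seq (\<kappa> i)) \<le> \<eta>"
      using close \<eta>'(2) by (meson order_trans)
    ultimately show ?thesis by blast
  qed
  with \<delta> that show ?thesis by blast
qed

text \<open>The signed permutation sends \<open>s\<^sub>i e\<^bsub>\<kappa> i\<^esub>\<close> to \<open>r\<^sub>i e\<^bsub>\<iota> i\<^esub>\<close>, so \<open>g \<circ> S\<close> and \<open>T\<close> differ by at most \<open>2 \<eta>\<close>
  on each of the \<open>n\<close> unit vectors; the coordinates of a vector in the unit ball are at most \<open>1\<close>.\<close>

lemma Iso_moves_near:
  assumes S: "linear_map_on (coord_space n) S" "\<And>x. x \<in> coord_space n \<Longrightarrow> S x \<in> X"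
      "inj_on \<kappa> {..<n}" "\<And>i. i < n \<Longrightarrow> \<bar>s i\<bar> = 1 \<and> N (S (unit_seq i) - s i *\<^sub>R unit_seq (\<kappa> i)) \<le> \<eta>"
    and T: "linear_map_on (coord_space n) T" "\<And>x. x \<in> coord_space n \<Longrightarrow> T x \<in> X"
      "inj_on \<iota> {..<n}" "\<And>i. i < n \<Longrightarrow> \<bar>r i\<bar> = 1 \<and> N (T (unit_seq i) - r i *\<^sub>R unit_seq (\<iota> i)) \<le> \<eta>"
  obtains g where "g \<in> Iso X N"
    "opdist N (coord_space n) T (compose (coord_space n) g S) \<le> ereal (real n * (2 * \<eta>))"
proof -
  let ?E = "coord_space n"
  obtain \<pi> where \<pi>: "bij \<pi>" "\<And>i. i \<in> {..<n} \<Longrightarrow> \<pi> (\<iota> i) = \<kappa> i"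
    using ex_bij_extension[OF finite_lessThan T(3) S(3)] by blast
  define c where "c k = (if k \<in> \<iota> ` {..<n} then let i = the_inv_into {..<n} \<iota> k in s i * r i else 1)" for k
  have c: "c (\<iota> i) = s i * r i" if "i < n" for i
    using that T(3) by (simp add: c_def the_inv_into_f_f Let_def)
  have c_abs: "\<bar>c k\<bar> = 1" for k
  proof (cases "k \<in> \<iota> ` {..<n}")
    case True
    then obtain i where "i < n" "k = \<iota> i" by auto
    then show ?thesis using S(4)[of i] T(4)[of i] by (simp add: c abs_mult)
  qed (simp add: c_def)
  define g where "g = signed_permutation c \<pi>"
  have g: "g \<in> Iso X N" unfolding g_def by (rule signed_permutation_Iso[OF \<pi>(1) c_abs])
  have g_lin: "g (x + y) = g x + g y" "g (c *\<^sub>R x) = c *\<^sub>R g x" and g_mem: "g x \<in> X" and g_norm: "N (g x) = N x"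
    if "x \<in> X" "y \<in> X" for x y c
    using g that by (auto simp: Iso_def linear_map_on_def)
  have g_diff: "g (x - y) = g x - g y" if "x \<in> X" "y \<in> X" for x y
    using g_lin(1)[of "x - y" y] that by (simp add: mem_intros)
  have g_unit: "g (s i *\<^sub>R unit_seq (\<kappa> i)) = r i *\<^sub>R unit_seq (\<iota> i)" if "i < n" for i
  proof -
    have "g (s i *\<^sub>R unit_seq (\<kappa> i)) = s i *\<^sub>R c (\<iota> i) *\<^sub>R unit_seq (\<iota> i)"
      using g_lin(2)[OF unit_seq_mem unit_seq_mem] signed_permutation_unit_seq[OF \<pi>(1) \<pi>(2), of i] that
      by (simp add: g_def)
    moreover have "s i * (s i * r i) = r i"
      using S(4)[OF that] abs_mult_self_eq[of "s i"] by (simp add: mult.assoc[symmetric])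
    ultimately show ?thesis using c[OF that] by simp
  qed
  define L where "L x = T x - compose ?E g S x" for x
  have L: "L x = T x - g (S x)" if "x \<in> ?E" for x
    using that by (simp add: L_def compose_def)
  have L_lin: "linear_map_on ?E L"
    unfolding linear_map_on_def
  proof (intro conjI ballI allI)
    fix x y assume xy: "x \<in> ?E" "y \<in> ?E"
    then have "T (x + y) = T x + T y" "S (x + y) = S x + S y"
      using S(1) T(1) by (simp_all add: linear_map_on_def)
    then show "L (x + y) = L x + L y"
      using xy g_lin(1)[OF S(2) S(2), of x y] by (simp add: L span_add del: plus_fun_apply)
  next
    fix a x assume x: "x \<in> ?E"
    then have "T (a *\<^sub>R x) = a *\<^sub>R T x" "S (a *\<^sub>R x) = a *\<^sub>R S x"
      using S(1) T(1) by (simp_all add: linear_map_on_def)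
    then show "L (a *\<^sub>R x) = a *\<^sub>R L x"
      using x g_lin(2)[OF S(2) S(2), of x x a] by (simp add: L span_scale scaleR_right_diff_distrib)
  qed
  have unit: "unit_seq i \<in> ?E" if "i < n" for i using that by (auto intro: span_base)
  have L_mem: "L (unit_seq i) \<in> X" if "i < n" for i
    using that unit by (auto simp: L intro!: subspace_diff[OF subspace_space] T(2) g_mem S(2))
  have L_unit: "N (L (unit_seq i)) \<le> 2 * \<eta>" if "i < n" for i
  proof -
    let ?e = "s i *\<^sub>R unit_seq (\<kappa> i)" and ?f = "r i *\<^sub>R unit_seq (\<iota> i)"
    have mem: "?e \<in> X" "?f \<in> X" "S (unit_seq i) \<in> X" "T (unit_seq i) \<in> X"
      using that unit S(2) T(2) by (auto intro!: mem_intros unit_seq_mem)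
    have "N (L (unit_seq i)) \<le> N (T (unit_seq i) - ?f) + N (?f - g (S (unit_seq i)))"
      using mem by (simp add: L unit that) (intro norm_triangle g_mem, auto)
    also have "?f - g (S (unit_seq i)) = g (?e - S (unit_seq i))"
      using mem that by (simp add: g_diff g_unit)
    also have "N \<dots> = N (S (unit_seq i) - ?e)"
      using mem g_norm[of "?e - S (unit_seq i)"] norm_minus_commute[of ?e "S (unit_seq i)"] by (simp add: mem_intros)
    also have "N (T (unit_seq i) - ?f) + N (S (unit_seq i) - ?e) \<le> \<eta> + \<eta>"
      using S(4)[OF that] T(4)[OF that] by (intro add_mono) auto
    finally show ?thesis by simp
  qed
  have "N (L x) \<le> real n * (2 * \<eta>)" if x: "x \<in> ?E" "N x \<le> 1" for x
  proof -
    have "x \<in> X" using x coord_space_subset by blast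
    have "L x = L (\<Sum>i<n. x i *\<^sub>R unit_seq i)"
      using trunc_coord_space[OF x(1)] by (simp add: trunc_eq_sum)
    also have "\<dots> = (\<Sum>i<n. L (x i *\<^sub>R unit_seq i))"
      by (rule linear_map_on_sum[OF subspace_span L_lin]) (auto intro: span_scale unit)
    also have "\<dots> = (\<Sum>i<n. x i *\<^sub>R L (unit_seq i))"
      using L_lin unit by (intro sum.cong) (auto simp: linear_map_on_def)
    finally have "N (L x) = N (\<Sum>i<n. x i *\<^sub>R L (unit_seq i))" by (rule arg_cong)
    also have "\<dots> \<le> (\<Sum>i<n. N (x i *\<^sub>R L (unit_seq i)))"
      using L_mem by (intro norm_sum_le mem_intros) auto
    also have "\<dots> \<le> (\<Sum>i<n. 2 * \<eta>)"
    proof (rule sum_mono)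
      fix i assume i: "i \<in> {..<n}"
      have "\<bar>x i\<bar> * N (L (unit_seq i)) \<le> 1 * (2 * \<eta>)"
        using abs_le_norm[OF \<open>x \<in> X\<close>, of i] x i L_unit by (intro mult_mono) auto
      then show "N (x i *\<^sub>R L (unit_seq i)) \<le> 2 * \<eta>" using i L_mem by (simp add: norm_scaleR)
    qed
    finally show ?thesis by simp
  qed
  then have "opdist N ?E T (compose ?E g S) \<le> ereal (real n * (2 * \<eta>))"
    unfolding opdist_def opnorm_def L_def[symmetric] by (intro SUP_least) auto
  with g that show ?thesis by blast
qed

theorem cofinally_Fraisse: "cofinally_Fraisse X N"
  unfolding cofinally_Fraisse_def
proof (intro conjI allI impI)
  show "separable_banach_on X N"
    unfolding separable_banach_on_def by (intro conjI normed_space complete separable)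
next
  fix \<epsilon> :: real assume "0 < \<epsilon>"
  have "\<exists>\<delta>>0. acts_eps_transitively \<epsilon> (Iso X N) (compose (coord_space n)) (Emb X N (1 + \<delta>) (coord_space n))
      (opdist N (coord_space n))" if n: "2 \<le> n" for n
  proof -
    define \<eta> where "\<eta> = \<epsilon> / (2 * real n)"
    have \<eta>: "0 < \<eta>" "real n * (2 * \<eta>) = \<epsilon>" using \<open>0 < \<epsilon>\<close> that by (auto simp: \<eta>_def)
    obtain \<delta> where "0 < \<delta>" and close: "\<And>T. near_isometry (1 + \<delta>) n T \<Longrightarrow>
      \<exists>\<kappa> s. inj_on \<kappa> {..<n} \<and> (\<forall>i<n. \<bar>s i\<bar> = 1 \<and> N (T (unit_seq i) - s i *\<^sub>R unit_seq (\<kappa> i)) \<le> \<eta>)"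
      using near_isometry_signed_permutation[OF \<eta>(1) n] by blast
    have "dist_to_set (opdist N (coord_space n)) T ((\<lambda>g. compose (coord_space n) g S) ` Iso X N) \<le> ereal \<epsilon>"
      if "S \<in> Emb X N (1 + \<delta>) (coord_space n)" "T \<in> Emb X N (1 + \<delta>) (coord_space n)" for S T
    proof -
      have S: "near_isometry (1 + \<delta>) n S" and T: "near_isometry (1 + \<delta>) n T"
        using that by (simp_all add: Emb_near_isometry)
      obtain \<kappa> s where \<kappa>: "inj_on \<kappa> {..<n}"
        "\<And>i. i < n \<Longrightarrow> \<bar>s i\<bar> = 1 \<and> N (S (unit_seq i) - s i *\<^sub>R unit_seq (\<kappa> i)) \<le> \<eta>"
        using close[OF S] by blast
      obtain \<iota> r where \<iota>: "inj_on \<iota> {..<n}"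
        "\<And>i. i < n \<Longrightarrow> \<bar>r i\<bar> = 1 \<and> N (T (unit_seq i) - r i *\<^sub>R unit_seq (\<iota> i)) \<le> \<eta>"
        using close[OF T] by blast
      have lin: "linear_map_on (coord_space n) S" "linear_map_on (coord_space n) T"
        and mem: "\<And>x. x \<in> coord_space n \<Longrightarrow> S x \<in> X" "\<And>x. x \<in> coord_space n \<Longrightarrow> T x \<in> X"
        using S T by (simp_all add: near_isometry_def)
      obtain g where g: "g \<in> Iso X N"
        "opdist N (coord_space n) T (compose (coord_space n) g S) \<le> ereal (real n * (2 * \<eta>))"
        by (rule Iso_moves_near[OF lin(1) mem(1) \<kappa> lin(2) mem(2) \<iota>])
      then show ?thesis
        unfolding dist_to_set_def \<eta>(2) by (intro INF_lower2[of "compose (coord_space n) g S"] imageI)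
    qed
    with \<open>0 < \<delta>\<close> show ?thesis unfolding acts_eps_transitively_def by blast
  qed
  with coord_spaces_cofinal
  show "\<exists>\<F>. cofinal_class X N \<F> \<and> (\<forall>E\<in>\<F>. \<exists>\<delta>>0.
      acts_eps_transitively \<epsilon> (Iso X N) (compose E) (Emb X N (1 + \<delta>) E) (opdist N E))"
    by (intro exI[of _ "coord_space ` {2..}"]) auto
qed

end

theorem corollary1p10:
  fixes M :: "real \<Rightarrow> real"
  assumes "orlicz_function M"
    and "C_k_on 3 {0..} M"
    and "mono_on {0..} (nth_deriv_on {0..} 3 M)"
    and "M \<in> o[at_right 0](\<lambda>t. t ^ 3)"
    and "Delta_2pp M"
    and "M 1 = 1"
    and "\<And>\<epsilon>::real. \<epsilon> > 0 \<Longrightarrow>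
           \<exists>\<alpha>>1. \<forall>t u. 0 < t \<and> t \<le> 1 - \<epsilon> \<and> 0 < u \<and> u \<le> 1 - \<epsilon> \<longrightarrow>
             M (t * u) \<ge> \<alpha> * M t * M u"
  shows "cofinally_Fraisse (orlicz_space M) (orlicz_norm M)"
proof -
  have cvx: "convex_on {0..} M" and zero: "M 0 = 0" and nonneg: "\<And>t. t \<ge> 0 \<Longrightarrow> 0 \<le> M t"
    using assms(1) by (auto simp: orlicz_function_def)
  have "M differentiable_on {0..}" using assms(2) by (auto simp: C_k_on_def dest: spec[of _ 0])
  then have cont: "continuous_on {0..} M" by (rule differentiable_imp_continuous_on)
  \<comment> \<open>The quotients in the \<open>\<Delta>\<^sub>2\<^sub>+\<^sub>+\<close>-condition presuppose that \<open>M\<close> does not vanish near \<open>0\<close>; by convexity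
    it then vanishes nowhere on \<open>(0,\<infinity>)\<close>.\<close>
  have pos: "0 < M t" if "0 < t" for t
  proof -
    have "\<forall>\<^sub>F t in at_right 0. M t \<noteq> 0"
      using assms(5) by (auto simp: Delta_2pp_def)
    then obtain b where b: "b > 0" "\<And>u. 0 < u \<Longrightarrow> u < b \<Longrightarrow> M u \<noteq> 0"
      unfolding eventually_at_right_field by blast
    define u where "u = min (t / 2) (b / 2)"
    have u: "0 < u" "u < b" "u < t" using b that by (auto simp: u_def)
    then have "0 < M u" using b(2)[of u] nonneg[of u] by simp
    also have "M u \<le> u / t * M t"
      using convex_onD[OF cvx, of "u / t" 0 t] u that zero by simp
    finally show ?thesis using u that by (simp add: zero_less_divide_iff zero_less_mult_iff)
  qed
  have supermult: "M t * M u \<le> M (t * u)" if "0 \<le> t" "t \<le> 1" "0 \<le> u" "u \<le> 1" for t u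
  proof -
    consider "t = 0" | "t = 1" | "u = 0" | "u = 1" | "0 < t" "t < 1" "0 < u" "u < 1"
      using \<open>0 \<le> t\<close> \<open>t \<le> 1\<close> \<open>0 \<le> u\<close> \<open>u \<le> 1\<close> by linarith
    then show ?thesis
    proof cases
      case 5
      then have "min (1 - t) (1 - u) > 0" by simp
      then obtain \<alpha> where "\<alpha> > 1" and \<alpha>: "\<alpha> * M t * M u \<le> M (t * u)"
        using assms(7)[of "min (1 - t) (1 - u)"] 5 by force
      have "1 * (M t * M u) \<le> \<alpha> * (M t * M u)"
        using \<open>\<alpha> > 1\<close> nonneg 5 by (intro mult_right_mono) auto
      with \<alpha> show ?thesis by (simp add: mult.assoc)
    qed (use assms(6) zero in auto)
  qed
  interpret rigid_orlicz M
    by unfold_locales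
      (fact cvx zero assms(6) pos cont supermult clarkson_if_C3[OF assms(1-4)] assms(7))+
  show ?thesis by (rule cofinally_Fraisse)
qed

end
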